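(* Let $m\ge2$ be an integer, let $N\ge1$ be an odd integer and let $M$ be an integer coprime to $N$, so that $\zeta_N^M=e^{2\pi iM/N}$ is a primitive $N$th root of unity with $N$ odd. Then the radial limit below exists and $$\lim_{q\to\zeta_N^M}\widetilde{\Gamma}_m(q)=\zeta_N^{\frac{M(2m-3)^2}{8(m-1)}}\,U_{m,N}(\zeta_N^M).$$
   Context: Empty sums are $0$ and empty products are $1$. $(x;q)_n=\prod_{j=0}^{n-1}(1-xq^j)$ and $(x)_n=(x;q)_n$. The Gaussian polynomial in base $q^2$ is $\begin{bmatrix} n\\k\end{bmatrix}_{q^2}=\frac{(q^2;q^2)_n}{(q^2;q^2)_{n-k}(q^2;q^2)_k}$ if $0\le k\le n$ and $0$ otherwise; it is a polynomial in $q$ and is evaluated at roots of unity as such. For $m\ge2$ and $|q|<1$, $$\widetilde{\Gamma}_m(q)=(m-1)\,q^{\frac{(2m-3)^2}{8(m-1)}}\sum_{n_1,\dots,n_{m-1}\ge0}\frac{(-1)^{n_{m-1}}q^{2\binom{n_{m-1}+1}{2}+\sum_{i=1}^{m-2}(2n_i^2+2n_i)}(q;q^2)_{n_1}}{(-q)_{2n_1+1}}\prod_{i=1}^{m-2}\begin{bmatrix} n_{i+1}\\ n_i\end{bmatrix}_{q^2},$$ and $$U_{m,N}(q)=\sum_{n_1,\dots,n_{m-1}=0}^{N-1}\frac{(-1)^{n_{m-1}}q^{2\binom{n_{m-1}+1}{2}+\sum_{i=1}^{m-2}(2n_i^2+2n_i)}(q;q^2)_{n_1}}{(-q)_{2n_1+1}}\prod_{i=1}^{m-2}\begin{bmatrix}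 n_{i+1}\\ n_i\end{bmatrix}_{q^2}.$$ Conventions: $\zeta_N=e^{2\pi i/N}$ and $\zeta_N^{r}=e^{2\pi i r/N}$ for rational $r$. Write $q=e^{2\pi i\tau}$ with $\operatorname{Im}\tau>0$ and $q^r=e^{2\pi i r\tau}$ for rational $r$; $\lim_{q\to\zeta_N^M}$ denotes the radial limit from inside the unit disk, i.e. $\tau=\frac MN+i\frac{t}{2\pi}$ with $t\searrow0$. *)

theory Defs
  imports "HOL-Analysis.Analysis" "HOL-Computational_Algebra.Computational_Algebra"
begin

definition qpoch :: "'a::comm_ring_1 \<Rightarrow> 'a \<Rightarrow> nat \<Rightarrow> 'a" where
  "qpoch x q n = (\<Prod>j<n. 1 - x * q ^ j)"

text \<open>
  The Gaussian polynomial in base \<open>q\<^sup>2\<close>, as an element of the polynomial ring in the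
  indeterminate \<open>q = [:0, 1:]\<close>, so that it can be evaluated at roots of unity. The division
  is exact, see \<open>gauss_poly_mult\<close> below.
\<close>

definition gauss_poly :: "nat \<Rightarrow> nat \<Rightarrow> complex poly" where
  "gauss_poly n k =
     (if k \<le> n
      then qpoch ([:0, 1:]\<^sup>2) ([:0, 1:]\<^sup>2) n div
           (qpoch ([:0, 1:]\<^sup>2) ([:0, 1:]\<^sup>2) (n - k) * qpoch ([:0, 1:]\<^sup>2) ([:0, 1:]\<^sup>2) k)
      else 0)"

lemma qpoch_mult_dvd:
  fixes x :: "'a::comm_ring_1"
  shows "qpoch x x l * qpoch x x k dvd qpoch x x (l + k)"
proof (induction "l + k" arbitrary: l k rule: less_induct)
  case less
  show ?case
  proof (cases "l = 0 \<or> k = 0")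
    case True
    then show ?thesis by (auto simp: qpoch_def)
  next
    case False
    then obtain a b where l: "l = Suc a" and k: "k = Suc b"
      by (metis not0_implies_Suc)
    have Suc_eq: "qpoch x x (Suc n) = qpoch x x n * (1 - x ^ Suc n)" for n
      by (simp add: qpoch_def)
    have "qpoch x x a * qpoch x x k dvd qpoch x x (Suc (a + b))"
      using less[of a k] by (simp add: l k)
    then have 1: "qpoch x x l * qpoch x x k dvd qpoch x x (Suc (a + b)) * (1 - x ^ Suc a)"
      unfolding l Suc_eq[of a] by (metis mult.assoc mult.commute mult_dvd_mono dvd_refl)
    have "qpoch x x l * qpoch x x b dvd qpoch x x (Suc (a + b))"
      using less[of l b] by (simp add: l k)
    then have 2: "qpoch x x l * qpoch x x k dvd
                  qpoch x x (Suc (a + b)) * (1 - x ^ Suc b) * x ^ Suc a"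
      unfolding k Suc_eq[of b] by (metis mult.assoc mult_dvd_mono dvd_refl dvd_mult2)
    have "qpoch x x (l + k) = qpoch x x (Suc (a + b)) * (1 - x ^ Suc (Suc (a + b)))"
      by (simp add: l k Suc_eq)
    also have "1 - x ^ Suc (Suc (a + b)) = (1 - x ^ Suc a) + (1 - x ^ Suc b) * x ^ Suc a"
      by (simp add: algebra_simps power_add)
    finally have "qpoch x x (l + k) = qpoch x x (Suc (a + b)) * (1 - x ^ Suc a) +
        qpoch x x (Suc (a + b)) * (1 - x ^ Suc b) * x ^ Suc a"
      by (simp only: distrib_left mult.assoc)
    then show ?thesis using 1 2 by simp
  qed
qed

lemma gauss_poly_mult:
  assumes "k \<le> n"
  shows "gauss_poly n k *
           (qpoch ([:0, 1:]\<^sup>2) ([:0, 1:]\<^sup>2) (n - k) * qpoch ([:0, 1:]\<^sup>2) ([:0, 1:]\<^sup>2) k) =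
         qpoch ([:0, 1:]\<^sup>2) ([:0, 1:]\<^sup>2) n"
  using qpoch_mult_dvd[of "[:0, 1:]\<^sup>2 :: complex poly" "n - k" k] assms
  by (simp add: gauss_poly_def)

definition summand :: "nat \<Rightarrow> complex \<Rightarrow> (nat \<Rightarrow> nat) \<Rightarrow> complex" where
  "summand m q n =
     (-1) ^ n (m - 1)
     * q ^ (2 * ((n (m - 1) + 1) choose 2) + (\<Sum>i=1..m-2. 2 * (n i)\<^sup>2 + 2 * n i))
     * qpoch q (q\<^sup>2) (n 1) / qpoch (-q) q (2 * n 1 + 1)
     * (\<Prod>i=1..m-2. poly (gauss_poly (n (i + 1)) (n i)) q)"

text \<open>
  Multi-indices \<open>(n\<^sub>1, \<dots>, n\<^sub>m\<^sub>-\<^sub>1)\<close> are extensional functions on \<open>{1..m-1}\<close>.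
  The fractional power \<open>q\<^sup>r\<close> means \<open>exp (2 \<pi> \<i> r \<tau>)\<close>, so the function is one of \<open>\<tau>\<close>
  (in the upper half plane) rather than of \<open>q = exp (2 \<pi> \<i> \<tau>)\<close>. There the series converges absolutely (its terms vanish
  unless \<open>n\<^sub>1 \<le> \<dots> \<le> n\<^sub>m\<^sub>-\<^sub>1\<close>), so the unordered sum is the intended one.
\<close>

definition Gamma_tilde :: "nat \<Rightarrow> complex \<Rightarrow> complex" where
  "Gamma_tilde m \<tau> =
     of_nat (m - 1)
     * exp (2 * of_real pi * \<i> * of_real ((2 * real m - 3)\<^sup>2 / (8 * (real m - 1))) * \<tau>)
     * (\<Sum>\<^sub>\<infinity>n\<in>({1..m-1} \<rightarrow>\<^sub>E UNIV). summand m (exp (2 * of_real pi * \<i> * \<tau>)) n)"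

definition U :: "nat \<Rightarrow> nat \<Rightarrow> complex \<Rightarrow> complex" where
  "U m N q = (\<Sum>n\<in>({1..m-1} \<rightarrow>\<^sub>E {0..<N}). summand m q n)"

definition zeta_pow :: "nat \<Rightarrow> real \<Rightarrow> complex" where
  "zeta_pow N r = exp (2 * of_real pi * \<i> * of_real r / of_nat N)"

end

theory Submission
  imports Defs
begin

text \<open>
  Write \<open>Q = q\<^sup>2\<close>. Inside the unit disk the multiple series collapses to a single partial theta
  series: iterating the Bailey chain, started at a pair for \<open>(q;q\<^sup>2)\<^sub>n / (-q;q)\<^sub>2\<^sub>n\<^sub>+\<^sub>1\<close> and closed by an
  alternating sum over the last index, gives
  \<open>\<Sum>\<^sub>r q^(A r\<^sup>2 + (A - 1) r) (1 - q^(2 r + 1))\<close> with \<open>A = 2 m - 2\<close>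
  (lemma \<open>infsum_summand_sums\<close>). At a root of unity \<open>\<zeta>\<close> the coefficients of this series are periodic
  with vanishing sum over a period, so its radial limit exists and is a finite sum
  (\<open>partial_theta_radial_limit\<close>).

  The passage through the theta series cannot be replaced by a termwise limit: for \<open>m \<ge> 3\<close> only \<open>n\<^sub>1\<close>
  is bounded at \<open>\<zeta>\<close>, and by the Lucas congruence for Gaussian polynomials the terms of the multiple
  series reproduce those of \<open>U\<close> in blocks, weighted by \<open>\<Sum>\<^sub>a (-1)^a (m - 2)^a\<close>. This sum is
  \<open>1 / (m - 1)\<close> only after a regularisation, which is what the factor \<open>m - 1\<close> compensates.

  The same chain, with all indices cut off below \<open>L\<close>, expresses \<open>U m L q\<close> as the first \<open>L\<close> terms of the
  theta series, each multiplied by a normalised tail of the closing alternating sum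
  (\<open>U_eq_alt_tail\<close>). These tails satisfy a first order recurrence and so have a closed form
  (\<open>alt_tail_closed\<close>). Letting \<open>L\<close> tend to infinity yields the theta series. Taking \<open>L = N\<close> and letting
  \<open>q\<close> tend to \<open>\<zeta>\<close>, every tail has the same simple pole \<open>1 / (N (1 - q^(2 N)))\<close>, while the limits of
  the regular parts are symmetric under \<open>r \<mapsto> N - 1 - r\<close>. The theta terms are antisymmetric at \<open>\<zeta>\<close> under this reflection,
  so only the pole contributes: \<open>U m N \<zeta>\<close> is the limit of the truncated theta series
  divided by \<open>N (1 - q^(2 N))\<close> (\<open>U_at_root_of_unity\<close>). Both limits are now explicit
  combinations of the same \<open>N\<close> powers of \<open>\<zeta>\<close>, and they agree up to the factor \<open>m - 1\<close>.
\<close>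

section \<open>The Bailey chain\<close>

abbreviation qfact :: "'a::comm_ring_1 \<Rightarrow> nat \<Rightarrow> 'a" where
  "qfact Q n \<equiv> qpoch Q Q n"

lemma qpoch_0 [simp]: "qpoch x q 0 = 1"
  by (simp add: qpoch_def)

lemma qpoch_Suc: "qpoch x q (Suc n) = qpoch x q n * (1 - x * q ^ n)"
  by (simp add: qpoch_def)

lemma qfact_Suc: "qfact Q (Suc n) = qfact Q n * (1 - Q ^ Suc n)"
  by (simp add: qpoch_def)

lemma qfact_nonzero:
  fixes Q :: "'a::field"
  assumes "\<And>k. 0 < k \<Longrightarrow> k \<le> n \<Longrightarrow> Q ^ k \<noteq> 1"
  shows "qfact Q n \<noteq> 0"
  using assms by (induction n) (auto simp: qfact_Suc simp del: power_Suc)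

text \<open>
  The summation behind one step of the chain: the limiting case of the \<open>q\<close>-Vandermonde sum. Splitting
  \<open>1 - Q^L = (1 - Q^(L - i)) + Q^(L - i) (1 - Q^i)\<close> and cancelling each part against one of the
  factorials expresses the sum for \<open>(L, c)\<close> through those for \<open>(L - 1, c)\<close> and \<open>(L - 1, c + 1)\<close>,
  so the shift \<open>c\<close> has to be generalised.
\<close>

lemma q_vandermonde_limit:
  fixes Q :: "'a::field"
  assumes nz: "\<And>k. 0 < k \<Longrightarrow> Q ^ k \<noteq> 1"
  shows "(\<Sum>i\<le>L. Q ^ (i * (i + c)) / (qfact Q i * qfact Q (L - i) * qfact Q (i + c)))
           = 1 / (qfact Q L * qfact Q (L + c))"
proof (induction L arbitrary: c)
  case 0
  then show ?case by simp
next
  case (Suc L)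
  have P: "qfact Q k \<noteq> 0" for k
    using nz by (intro qfact_nonzero) auto
  have N: "1 - Q ^ Suc k \<noteq> 0" for k
    using nz[of "Suc k"] by auto
  let ?v = "\<lambda>L c i. Q ^ (i * (i + c)) / (qfact Q i * qfact Q (L - i) * qfact Q (i + c))"
  have low: "(\<Sum>i\<le>Suc L. (1 - Q ^ (Suc L - i)) * ?v (Suc L) c i) = (\<Sum>i\<le>L. ?v L c i)"
  proof -
    have "(1 - Q ^ (Suc L - i)) * ?v (Suc L) c i = ?v L c i" if "i \<le> L" for i
      using P N[of "L - i"] that by (simp add: Suc_diff_le qfact_Suc field_simps del: power_Suc)
    then show ?thesis by (simp add: sum.atMost_Suc)
  qed
  have high: "(\<Sum>i\<le>Suc L. Q ^ (Suc L - i) * (1 - Q ^ i) * ?v (Suc L) c i)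
                = Q ^ (Suc L + c) * (\<Sum>i\<le>L. ?v L (Suc c) i)"
  proof -
    have "Q ^ (Suc L - Suc i) * (1 - Q ^ Suc i) * ?v (Suc L) c (Suc i) = Q ^ (Suc L + c) * ?v L (Suc c) i"
      if "i \<le> L" for i
    proof -
      have "Suc L - Suc i + Suc i * (Suc i + c) = Suc L + c + i * (i + Suc c)"
        using that by (simp add: algebra_simps)
      then have "Q ^ (Suc L - Suc i) * Q ^ (Suc i * (Suc i + c)) = Q ^ (Suc L + c) * Q ^ (i * (i + Suc c))"
        by (metis power_add)
      then show ?thesis
        using P N[of i] by (simp add: qfact_Suc divide_simps mult_ac del: power_Suc mult_Suc)
    qed
    then show ?thesis
      by (subst sum.atMost_Suc_shift) (simp add: sum_distrib_left del: power_Suc mult_Suc diff_Suc_Suc)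
  qed
  have "(1 - Q ^ Suc L) * (\<Sum>i\<le>Suc L. ?v (Suc L) c i)
        = (\<Sum>i\<le>Suc L. (1 - Q ^ (Suc L - i)) * ?v (Suc L) c i + Q ^ (Suc L - i) * (1 - Q ^ i) * ?v (Suc L) c i)"
    unfolding sum_distrib_left
  proof (rule sum.cong)
    fix i assume "i \<in> {..Suc L}"
    then have "Q ^ Suc L = Q ^ (Suc L - i) * Q ^ i" by (simp flip: power_add)
    then show "(1 - Q ^ Suc L) * ?v (Suc L) c i
      = (1 - Q ^ (Suc L - i)) * ?v (Suc L) c i + Q ^ (Suc L - i) * (1 - Q ^ i) * ?v (Suc L) c i"
      by (simp only: algebra_simps mult_1_left)
  qed simp
  also have "\<dots> = (\<Sum>i\<le>L. ?v L c i) + Q ^ (Suc L + c) * (\<Sum>i\<le>L. ?v L (Suc c) i)"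
    unfolding sum.distrib low high ..
  also have "\<dots> = 1 / (qfact Q L * qfact Q (L + c)) + Q ^ (Suc L + c) * (1 / (qfact Q L * qfact Q (L + Suc c)))"
    unfolding Suc.IH ..
  also have "\<dots> = 1 / (qfact Q L * qfact Q (Suc L + c))"
    using P N[of "L + c"] by (simp add: qfact_Suc divide_simps del: power_Suc)
  finally have "(1 - Q ^ Suc L) * (\<Sum>i\<le>Suc L. ?v (Suc L) c i) = 1 / (qfact Q L * qfact Q (Suc L + c))" .
  then have "(\<Sum>i\<le>Suc L. ?v (Suc L) c i) = 1 / (qfact Q L * qfact Q (Suc L + c)) / (1 - Q ^ Suc L)"
    by (subst nonzero_eq_divide_eq[OF N], subst mult.commute)
  then show ?case
    by (simp only: qfact_Suc[of Q L] divide_divide_eq_left mult_ac)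
qed

text \<open>
  Bailey pairs relative to \<open>Q\<close>, with the denominators \<open>(Q\<^sup>2;Q)\<close> replaced by \<open>(Q;Q)\<close>, which
  only rescales the coefficients \<open>a\<close> by the constant \<open>1 - Q\<close>: summing the second member of a pair
  against \<open>Q^(j\<^sup>2 + j) / (Q;Q)\<close> multiplies \<open>a r\<close> by \<open>Q^(r\<^sup>2 + r)\<close>.
\<close>

lemma bailey_pair_chain:
  fixes Q :: "'a::field"
  assumes nz: "\<And>k. 0 < k \<Longrightarrow> Q ^ k \<noteq> 1"
  shows "(\<Sum>j\<le>n. Q ^ (j\<^sup>2 + j) / qfact Q (n - j) * (\<Sum>r\<le>j. a r / (qfact Q (j - r) * qfact Q (j + r + 1))))
       = (\<Sum>r\<le>n. Q ^ (r\<^sup>2 + r) * a r / (qfact Q (n - r) * qfact Q (n + r + 1)))"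
proof -
  have "(\<Sum>j\<le>n. Q ^ (j\<^sup>2 + j) / qfact Q (n - j) * (\<Sum>r\<le>j. a r / (qfact Q (j - r) * qfact Q (j + r + 1))))
      = (\<Sum>j\<le>n. \<Sum>r\<le>j. Q ^ (j\<^sup>2 + j) / qfact Q (n - j) * (a r / (qfact Q (j - r) * qfact Q (j + r + 1))))"
    by (simp add: sum_distrib_left)
  also have "\<dots> = (\<Sum>r\<le>n. \<Sum>j=r..n. Q ^ (j\<^sup>2 + j) / qfact Q (n - j) * (a r / (qfact Q (j - r) * qfact Q (j + r + 1))))"
    by (subst (1 2) sum.Sigma) (auto intro!: sum.reindex_bij_witness[of _ prod.swap prod.swap])
  also have "\<dots> = (\<Sum>r\<le>n. Q ^ (r\<^sup>2 + r) * a r / (qfact Q (n - r) * qfact Q (n + r + 1)))"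
  proof (rule sum.cong)
    fix r assume "r \<in> {..n}"
    then have r: "r \<le> n" by simp
    have "(\<Sum>j=r..n. Q ^ (j\<^sup>2 + j) / qfact Q (n - j) * (a r / (qfact Q (j - r) * qfact Q (j + r + 1))))
        = (\<Sum>i\<le>n - r. Q ^ ((i + r)\<^sup>2 + (i + r)) / qfact Q (n - (i + r)) * (a r / (qfact Q i * qfact Q (i + r + r + 1))))"
      by (rule sum.reindex_bij_witness[of _ "\<lambda>i. i + r" "\<lambda>j. j - r"]) (use r in auto)
    also have "\<dots> = (\<Sum>i\<le>n - r. Q ^ (r\<^sup>2 + r) * a r * (Q ^ (i * (i + (2 * r + 1))) /
                      (qfact Q i * qfact Q (n - r - i) * qfact Q (i + (2 * r + 1)))))"
    proof (rule sum.cong)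
      fix i
      have "(i + r)\<^sup>2 + (i + r) = r\<^sup>2 + r + i * (i + (2 * r + 1))"
        by (simp add: power2_eq_square algebra_simps)
      moreover have "n - (i + r) = n - r - i" "i + r + r + 1 = i + (2 * r + 1)" by auto
      ultimately show "Q ^ ((i + r)\<^sup>2 + (i + r)) / qfact Q (n - (i + r)) * (a r / (qfact Q i * qfact Q (i + r + r + 1)))
        = Q ^ (r\<^sup>2 + r) * a r * (Q ^ (i * (i + (2 * r + 1))) /
                      (qfact Q i * qfact Q (n - r - i) * qfact Q (i + (2 * r + 1))))"
        by (simp only: power_add[of Q "r\<^sup>2 + r"] times_divide_times_eq times_divide_eq_right times_divide_eq_left
             divide_divide_eq_left mult_ac)
    qed simp
    also have "\<dots> = Q ^ (r\<^sup>2 + r) * a r * (1 / (qfact Q (n - r) * qfact Q (n - r + (2 * r + 1))))"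
      unfolding sum_distrib_left[symmetric] by (subst q_vandermonde_limit[OF nz]) auto
    also have "n - r + (2 * r + 1) = n + r + 1" using r by simp
    finally show "(\<Sum>j=r..n. Q ^ (j\<^sup>2 + j) / qfact Q (n - j) * (a r / (qfact Q (j - r) * qfact Q (j + r + 1))))
      = Q ^ (r\<^sup>2 + r) * a r / (qfact Q (n - r) * qfact Q (n + r + 1))" by simp
  qed simp
  finally show ?thesis .
qed

text \<open>
  The starting pair is proved by creative telescoping: both sides satisfy the same first order
  recurrence in \<open>n\<close>. After clearing denominators the certificate reduces to this identity, in
  which \<open>X = q^r\<close>, \<open>Y = q^(n - r)\<close>, and \<open>E\<close> is the sign and Gaussian factor of the summand.
\<close>

lemma seed_certificate_polynomial:
  fixes q X Y :: "'a::comm_ring_1"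
  shows "(1 - q ^ 4 * X ^ 4 * Y ^ 4) * (1 - q ^ 6 * X ^ 4 * Y ^ 4) * (E * (1 - q * X\<^sup>2))
    - (1 - q * X\<^sup>2 * Y\<^sup>2) * (1 - q ^ 3 * X\<^sup>2 * Y\<^sup>2) *
        (E * (1 - q * X\<^sup>2) * ((1 - q\<^sup>2 * Y\<^sup>2) * (1 - q ^ 4 * X ^ 4 * Y\<^sup>2)))
    = - E * (q * X\<^sup>2) * Y\<^sup>2 * (1 - q ^ 3 * X\<^sup>2 * Y\<^sup>2) * (q ^ 4 * X ^ 4 - 1) * (1 - q\<^sup>2 * Y\<^sup>2)
      - E * (q\<^sup>2 * Y\<^sup>2) * (1 - q ^ 3 * X\<^sup>2 * Y\<^sup>2) * (X ^ 4 - 1) * (1 - q ^ 4 * X ^ 4 * Y\<^sup>2)"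
  by (simp add: algebra_simps eval_nat_numeral)

text \<open>
  The factor \<open>q^(4 r) - 1\<close> makes \<open>H\<close> vanish at \<open>r = 0\<close>, so that summing over \<open>r\<close> leaves only the
  boundary term at the upper end. Together with \<open>q^(2 (n + 1 - r))\<close> it is
  \<open>q^(2 n + 2) (q^(2 r) - q^(- 2 r))\<close>, which is odd in \<open>r\<close>, with exponents in the natural numbers.
\<close>

lemma seed_certificate:
  fixes q :: "'a::field"
  assumes nz: "\<And>k. 0 < k \<Longrightarrow> q ^ (2 * k) \<noteq> 1"
  defines "b \<equiv> \<lambda>n r. (-1) ^ r * q ^ r\<^sup>2 * (1 - q ^ (2 * r + 1)) / (qfact (q\<^sup>2) (n - r) * qfact (q\<^sup>2) (n + r + 1))"
  defines "H \<equiv> \<lambda>n r. (-1) ^ r * q ^ r\<^sup>2 * q ^ (2 * (n + 1 - r)) * (1 - q ^ (2 * n + 3)) * (q ^ (4 * r) - 1)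
                  / (qfact (q\<^sup>2) (n + 1 - r) * qfact (q\<^sup>2) (n + 1 + r))"
  assumes r: "r \<le> n"
  shows "(1 - q ^ (4 * n + 4)) * (1 - q ^ (4 * n + 6)) * b (Suc n) r
           - (1 - q ^ (2 * n + 1)) * (1 - q ^ (2 * n + 3)) * b n r = H n (Suc r) - H n r"
proof -
  have P: "qfact (q\<^sup>2) k \<noteq> 0" for k
    using nz by (intro qfact_nonzero) (auto simp flip: power_mult)
  have N: "1 - q ^ (2 * k) \<noteq> 0" if "0 < k" for k
    using nz[of k] that by auto
  obtain d where n: "n = r + d" using r le_Suc_ex by blast
  define X Y where "X = q ^ r" and "Y = q ^ d"
  have P1: "qfact (q\<^sup>2) (Suc d) = qfact (q\<^sup>2) d * (1 - q\<^sup>2 * Y\<^sup>2)"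
    by (simp add: qfact_Suc Y_def power_add flip: power_mult) (simp add: mult.commute)
  have Q2: "(q\<^sup>2) ^ (2 * r + d + 2) = q ^ 4 * X ^ 4 * Y\<^sup>2"
  proof -
    have "2 * (2 * r + d + 2) = 4 + r * 4 + d * 2" by simp
    then show ?thesis
      by (simp only: X_def Y_def power_mult[symmetric] power_add[symmetric])
  qed
  have P2: "qfact (q\<^sup>2) (2 * r + d + 2) = qfact (q\<^sup>2) (2 * r + d + 1) * (1 - q ^ 4 * X ^ 4 * Y\<^sup>2)"
    using qfact_Suc[of "q\<^sup>2" "2 * r + d + 1"] Q2 by simp
  have n1: "1 - q\<^sup>2 * Y\<^sup>2 \<noteq> 0"
    using N[of "Suc d"] by (simp add: Y_def flip: power_mult power_add) (simp add: algebra_simps)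
  have n2: "1 - q ^ 4 * X ^ 4 * Y\<^sup>2 \<noteq> 0"
    using N[of "2 * r + d + 2"] unfolding power_mult Q2 by simp
  define E where "E = (-1) ^ r * q ^ r\<^sup>2"
  define p1 p2 where "p1 = qfact (q\<^sup>2) d" and "p2 = qfact (q\<^sup>2) (2 * r + d + 1)"
  have p: "p1 \<noteq> 0" "p2 \<noteq> 0" by (simp_all add: p1_def p2_def P)
  have b1: "b (Suc n) r = E * (1 - q * X\<^sup>2) / (p1 * (1 - q\<^sup>2 * Y\<^sup>2) * (p2 * (1 - q ^ 4 * X ^ 4 * Y\<^sup>2)))"
  proof -
    have "Suc n - r = Suc d" "Suc n + r + 1 = 2 * r + d + 2" by (auto simp: n)
    then show ?thesis
      unfolding b_def p1_def p2_def P1[symmetric] P2[symmetric] \<open>Suc n - r = Suc d\<close> \<open>Suc n + r + 1 = 2 * r + d + 2\<close>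
      by (simp add: E_def X_def mult.commute power_mult power_add)
  qed
  have b0: "b n r = E * (1 - q * X\<^sup>2) / (p1 * p2)"
  proof -
    have "n - r = d" "n + r + 1 = 2 * r + d + 1" by (auto simp: n)
    then show ?thesis
      unfolding b_def p1_def p2_def \<open>n - r = d\<close> \<open>n + r + 1 = 2 * r + d + 1\<close>
      by (simp add: E_def X_def mult.commute power_mult power_add)
  qed
  have y3: "q ^ (2 * n + 3) = q ^ 3 * X\<^sup>2 * Y\<^sup>2" and y1: "q ^ (2 * n + 1) = q * X\<^sup>2 * Y\<^sup>2"
    and y4: "q ^ (4 * n + 4) = q ^ 4 * X ^ 4 * Y ^ 4" and y6: "q ^ (4 * n + 6) = q ^ 6 * X ^ 4 * Y ^ 4"
    by (simp_all add: n X_def Y_def power_add power_mult algebra_simps flip: power_mult)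
  have H1: "H n (Suc r) = - E * (q * X\<^sup>2) * Y\<^sup>2 * (1 - q ^ 3 * X\<^sup>2 * Y\<^sup>2) * (q ^ 4 * X ^ 4 - 1)
              / (p1 * (p2 * (1 - q ^ 4 * X ^ 4 * Y\<^sup>2)))"
  proof -
    have e: "n + 1 - Suc r = d" "n + 1 + Suc r = 2 * r + d + 2" by (auto simp: n)
    have "(-1) ^ Suc r * q ^ (Suc r)\<^sup>2 = - E * (q * X\<^sup>2)"
      by (simp add: E_def X_def power2_eq_square power_add mult_2 algebra_simps)
    moreover have "q ^ (2 * d) = Y\<^sup>2" "q ^ (4 * Suc r) = q ^ 4 * X ^ 4"
      by (simp_all add: X_def Y_def mult.commute power_mult power_add)
    ultimately show ?thesis
      unfolding H_def e p1_def p2_def P2[symmetric] y3 by simp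
  qed
  have H0: "H n r = E * (q\<^sup>2 * Y\<^sup>2) * (1 - q ^ 3 * X\<^sup>2 * Y\<^sup>2) * (X ^ 4 - 1)
              / (p1 * (1 - q\<^sup>2 * Y\<^sup>2) * p2)"
  proof -
    have e: "n + 1 - r = Suc d" "n + 1 + r = 2 * r + d + 1" by (auto simp: n)
    have "q ^ (2 * Suc d) = q\<^sup>2 * Y\<^sup>2" "q ^ (4 * r) = X ^ 4"
      by (simp_all add: X_def Y_def mult.commute power_mult power2_eq_square power_add)
    then show ?thesis
      unfolding H_def e p1_def p2_def P1[symmetric] y3 E_def by simp
  qed
  define D where "D = p1 * (1 - q\<^sup>2 * Y\<^sup>2) * (p2 * (1 - q ^ 4 * X ^ 4 * Y\<^sup>2))"
  have "D \<noteq> 0" using p n1 n2 by (simp add: D_def)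
  have "b (Suc n) r = E * (1 - q * X\<^sup>2) / D" by (simp add: b1 D_def)
  moreover have "b n r = E * (1 - q * X\<^sup>2) * ((1 - q\<^sup>2 * Y\<^sup>2) * (1 - q ^ 4 * X ^ 4 * Y\<^sup>2)) / D"
    using p n1 n2 by (simp add: b0 D_def)
  moreover have "H n (Suc r) = - E * (q * X\<^sup>2) * Y\<^sup>2 * (1 - q ^ 3 * X\<^sup>2 * Y\<^sup>2) * (q ^ 4 * X ^ 4 - 1) * (1 - q\<^sup>2 * Y\<^sup>2) / D"
    using p n1 n2 by (simp add: H1 D_def)
  moreover have "H n r = E * (q\<^sup>2 * Y\<^sup>2) * (1 - q ^ 3 * X\<^sup>2 * Y\<^sup>2) * (X ^ 4 - 1) * (1 - q ^ 4 * X ^ 4 * Y\<^sup>2) / D"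
    using p n1 n2 by (simp add: H0 D_def mult.assoc)
  ultimately show ?thesis
    unfolding y1 y3 y4 y6 using \<open>D \<noteq> 0\<close> 
    by (simp only: times_divide_eq_right diff_divide_distrib[symmetric] seed_certificate_polynomial)
qed


text \<open>
  The pair from which the chain starts. Unfolded to a sum over all integers \<open>r\<close>, the right side is an
  instance of the finite Jacobi triple product with exponents \<open>r\<^sup>2\<close>.
\<close>

lemma seed_bailey_pair:
  fixes q :: "'a::field"
  assumes nz: "\<And>k. 0 < k \<Longrightarrow> q ^ (2 * k) \<noteq> 1"
  shows "qpoch q (q\<^sup>2) n / (qpoch (- q) q (2 * n + 1) * qfact (q\<^sup>2) n)
       = (\<Sum>r\<le>n. (-1) ^ r * q ^ r\<^sup>2 * (1 - q ^ (2 * r + 1))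
                   / (qfact (q\<^sup>2) (n - r) * qfact (q\<^sup>2) (n + r + 1)))"
proof (induction n)
  case 0
  have "(1 + q) * (1 - q) = 1 - q\<^sup>2" by (simp add: algebra_simps power2_eq_square)
  moreover have "1 - q\<^sup>2 \<noteq> 0" using nz[of 1] by simp
  ultimately have "1 / (1 + q) = (1 - q) / (1 - q\<^sup>2)"
    by (metis divide_eq_0_iff mult_eq_0_iff nonzero_divide_mult_cancel_right)
  then show ?case
    by (simp add: qpoch_def)
next
  case (Suc n)
  let ?P = "qfact (q\<^sup>2)"
  let ?b = "\<lambda>n r. (-1) ^ r * q ^ r\<^sup>2 * (1 - q ^ (2 * r + 1)) / (?P (n - r) * ?P (n + r + 1))"
  let ?H = "\<lambda>r. (-1) ^ r * q ^ r\<^sup>2 * q ^ (2 * (n + 1 - r)) * (1 - q ^ (2 * n + 3)) * (q ^ (4 * r) - 1)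
                  / (?P (n + 1 - r) * ?P (n + 1 + r))"
  let ?\<alpha> = "(1 - q ^ (4 * n + 4)) * (1 - q ^ (4 * n + 6))"
  let ?\<gamma> = "(1 - q ^ (2 * n + 1)) * (1 - q ^ (2 * n + 3))"
  have P: "?P k \<noteq> 0" for k
    using nz by (intro qfact_nonzero) (auto simp flip: power_mult)
  have N: "1 - q ^ (2 * k) \<noteq> 0" if "0 < k" for k
    using nz[of k] that by auto
  have \<alpha>: "1 - q ^ (4 * n + 4) \<noteq> 0" "1 - q ^ (4 * n + 6) \<noteq> 0"
    using N[of "2 * n + 2"] N[of "2 * n + 3"] by (simp_all only: distrib_left mult.assoc[symmetric]) simp_all
  \<comment> \<open>The sum for \<open>n + 1\<close> has one more summand than the telescoped range; the boundary term cancels it.\<close>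
  have "?\<alpha> * (\<Sum>r\<le>n. ?b (Suc n) r) - ?\<gamma> * (\<Sum>r\<le>n. ?b n r) = (\<Sum>r\<le>n. ?H (Suc r) - ?H r)"
    unfolding sum_distrib_left sum_subtractf[symmetric]
    by (intro sum.cong refl seed_certificate nz) auto
  also have "\<dots> = ?H (Suc n) - ?H 0"
    by (rule sum_Suc_diff[of 0 n, simplified atLeast0AtMost]) simp
  also have "\<dots> = - ?\<alpha> * ?b (Suc n) (Suc n)"
  proof -
    have "?P (Suc n + Suc n + 1) = ?P (n + 1 + Suc n) * (1 - q ^ (4 * n + 6))"
    proof -
      have "(q\<^sup>2) ^ Suc (n + 1 + Suc n) = q ^ (4 * n + 6)"
        unfolding power_mult[symmetric] by (rule arg_cong[of _ _ "(^) q"]) simp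
      then show ?thesis using qfact_Suc[of "q\<^sup>2" "n + 1 + Suc n"] by simp
    qed
    have cancel: "w \<noteq> 0 \<Longrightarrow> x * w * (y / (p * w)) = x * (y / p)" for w x y p :: 'a
      by simp
    have "?b (Suc n) (Suc n) = (-1) ^ Suc n * q ^ (Suc n)\<^sup>2 * (1 - q ^ (2 * n + 3)) / (?P (n + 1 + Suc n) * (1 - q ^ (4 * n + 6)))"
      using \<open>?P (Suc n + Suc n + 1) = _\<close> by (simp add: numeral_3_eq_3)
    then have "?\<alpha> * ?b (Suc n) (Suc n) = (1 - q ^ (4 * n + 4)) * ((-1) ^ Suc n * q ^ (Suc n)\<^sup>2 * (1 - q ^ (2 * n + 3)) / ?P (n + 1 + Suc n))"
      by (simp only: cancel[OF \<alpha>(2)])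
    moreover have "?H (Suc n) = - ((1 - q ^ (4 * n + 4)) * ((-1) ^ Suc n * q ^ (Suc n)\<^sup>2 * (1 - q ^ (2 * n + 3)) / ?P (n + 1 + Suc n)))"
    proof -
      have "q ^ (4 * Suc n) - 1 = - (1 - q ^ (4 * n + 4))" by (simp add: algebra_simps)
      then show ?thesis by (simp only: mult_minus_right minus_divide_left[symmetric]) (simp add: mult_ac)
    qed
    moreover have "?H 0 = 0" by simp
    ultimately show ?thesis by (simp only: mult_minus_left diff_zero)
  qed
  finally have rec: "?\<alpha> * (\<Sum>r\<le>Suc n. ?b (Suc n) r) = ?\<gamma> * (\<Sum>r\<le>n. ?b n r)"
    unfolding sum.atMost_Suc[of _ n] distrib_left[of ?\<alpha>] by (simp only: mult_minus_left diff_eq_eq) simp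
  have "qpoch (-q) q (2 * Suc n + 1) = qpoch (-q) q (2 * n + 1) * ((1 + q ^ (2 * n + 2)) * (1 + q ^ (2 * n + 3)))"
    by (simp add: qpoch_Suc eval_nat_numeral mult.assoc)
  moreover have "qpoch q (q\<^sup>2) (Suc n) = qpoch q (q\<^sup>2) n * (1 - q ^ (2 * n + 1))"
    by (simp add: qpoch_Suc flip: power_mult)
  moreover have "?P (Suc n) = ?P n * (1 - q ^ (2 * n + 2))"
    by (simp add: qpoch_Suc flip: power_mult power_add)
  ultimately have L: "qpoch q (q\<^sup>2) (Suc n) / (qpoch (- q) q (2 * Suc n + 1) * ?P (Suc n))
    = qpoch q (q\<^sup>2) n / (qpoch (- q) q (2 * n + 1) * ?P n) *
      ((1 - q ^ (2 * n + 1)) / ((1 + q ^ (2 * n + 2)) * (1 + q ^ (2 * n + 3)) * (1 - q ^ (2 * n + 2))))"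
    by (simp only: times_divide_times_eq mult_ac)
  have f: "1 - q ^ (4 * n + 4) = (1 - q ^ (2 * n + 2)) * (1 + q ^ (2 * n + 2))"
          "1 - q ^ (4 * n + 6) = (1 - q ^ (2 * n + 3)) * (1 + q ^ (2 * n + 3))"
  proof -
    have "q ^ (4 * n + 4) = q ^ (2 * n + 2) * q ^ (2 * n + 2)" "q ^ (4 * n + 6) = q ^ (2 * n + 3) * q ^ (2 * n + 3)"
      unfolding power_add[symmetric] by (rule arg_cong[of _ _ "(^) q"]; simp)+
    then show "1 - q ^ (4 * n + 4) = (1 - q ^ (2 * n + 2)) * (1 + q ^ (2 * n + 2))"
      "1 - q ^ (4 * n + 6) = (1 - q ^ (2 * n + 3)) * (1 + q ^ (2 * n + 3))"
      by (simp_all only: algebra_simps mult_1_left mult_1_right)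
  qed
  have nz': "1 - q ^ (2 * n + 2) \<noteq> 0" "1 + q ^ (2 * n + 2) \<noteq> 0" "1 - q ^ (2 * n + 3) \<noteq> 0" "1 + q ^ (2 * n + 3) \<noteq> 0"
    using \<alpha> unfolding f by simp_all
  have "(1 - q ^ (2 * n + 1)) / ((1 + q ^ (2 * n + 2)) * (1 + q ^ (2 * n + 3)) * (1 - q ^ (2 * n + 2))) = ?\<gamma> / ?\<alpha>"
    unfolding f using nz' by (simp add: divide_simps mult_ac)
  then have "qpoch q (q\<^sup>2) (Suc n) / (qpoch (- q) q (2 * Suc n + 1) * ?P (Suc n)) = (\<Sum>r\<le>n. ?b n r) * (?\<gamma> / ?\<alpha>)"
    unfolding L Suc.IH by simp
  also have "\<dots> = (\<Sum>r\<le>Suc n. ?b (Suc n) r)"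
  proof -
    have a: "?\<alpha> \<noteq> 0" using \<alpha> by (simp only: mult_eq_0_iff) simp
    have "(\<Sum>r\<le>n. ?b n r) * (?\<gamma> / ?\<alpha>) = ?\<gamma> * (\<Sum>r\<le>n. ?b n r) / ?\<alpha>"
      by (simp only: times_divide_eq_right) (simp only: mult.commute)
    also have "\<dots> = (\<Sum>r\<le>Suc n. ?b (Suc n) r)"
      unfolding rec[symmetric] by (rule nonzero_mult_div_cancel_left[OF a])
    finally show ?thesis .
  qed
  finally show ?case .
qed

section \<open>The closing alternating sum\<close>

text \<open>
  The weight that the truncated sum over the last index assigns to the coefficient with index \<open>r\<close> of a Bailey pair.
\<close>

definition alt_tail :: "'a::field \<Rightarrow> nat \<Rightarrow> nat \<Rightarrow> 'a" where
  "alt_tail q L r = (\<Sum>n\<in>{r..<L}. (-1) ^ n * q ^ (n\<^sup>2 + n) * qfact (q\<^sup>2) n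
                        / (qfact (q\<^sup>2) (n - r) * qfact (q\<^sup>2) (n + r + 1)))"

text \<open>
  Euler's expansion of \<open>(x;Q)\<^sub>\<infinity>\<close> at its zero \<open>x = 1\<close>, with the constant term moved to the
  other side and the sum truncated at \<open>L\<close>.
\<close>

lemma alt_tail_0:
  fixes q :: "'a::field"
  assumes nz: "\<And>k. 0 < k \<Longrightarrow> q ^ (2 * k) \<noteq> 1"
  shows "alt_tail q L 0 = 1 - (-1) ^ L * q ^ (L\<^sup>2 + L) / qfact (q\<^sup>2) L"
proof (induction L)
  case 0
  then show ?case by (simp add: alt_tail_def)
next
  case (Suc L)
  let ?P = "qfact (q\<^sup>2)"
  have P: "?P k \<noteq> 0" for k
    using nz by (intro qfact_nonzero) (auto simp flip: power_mult)
  have N: "1 - q ^ (2 * L + 2) \<noteq> 0"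
    using nz[of "L + 1"] by simp
  have S: "?P (Suc L) = ?P L * (1 - q ^ (2 * L + 2))"
    by (simp add: qpoch_Suc flip: power_mult power_add)
  have e: "(Suc L)\<^sup>2 + Suc L = L\<^sup>2 + L + (2 * L + 2)"
    by (simp add: power2_eq_square)
  have "alt_tail q (Suc L) 0 = alt_tail q L 0 + (-1) ^ L * q ^ (L\<^sup>2 + L) / ?P (Suc L)"
    using P by (simp add: alt_tail_def atLeast0LessThan)
  also have "\<dots> = 1 - (-1) ^ L * q ^ (L\<^sup>2 + L) * (1 / ?P L - 1 / ?P (Suc L))"
    unfolding Suc.IH by (simp add: algebra_simps)
  also have "1 / ?P L - 1 / ?P (Suc L) = - (q ^ (2 * L + 2)) / ?P (Suc L)"
    unfolding S using P[of L] N by (simp add: divide_simps)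
  finally show ?case
    unfolding e power_add[of q "L\<^sup>2 + L"] by simp
qed

text \<open>
  Neighbouring tails cancel up to a single boundary term at the truncation point: the combined
  summand is the difference in \<open>n\<close> of the right side with \<open>L\<close> replaced by \<open>n\<close>. The proof by
  induction on \<open>L\<close> is this telescoping.
\<close>

lemma alt_tail_Suc:
  fixes q :: "'a::field"
  assumes nz: "\<And>k. 0 < k \<Longrightarrow> q ^ (2 * k) \<noteq> 1"
    and L: "Suc r \<le> L"
  shows "alt_tail q L (Suc r) + q ^ (2 * r + 2) * alt_tail q L r
       = - (1 + q ^ (2 * r + 2)) * (-1) ^ L * q ^ (L\<^sup>2 + L) * qfact (q\<^sup>2) L
           / (qfact (q\<^sup>2) (L - Suc r) * qfact (q\<^sup>2) (L + Suc r))"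
  using L
proof (induction L rule: dec_induct)
  let ?P = "qfact (q\<^sup>2)"
  have P: "?P k \<noteq> 0" for k
    using nz by (intro qfact_nonzero) (auto simp flip: power_mult)
  have N: "1 - q ^ (2 * k + 2) \<noteq> 0" for k
    using nz[of "Suc k"] by simp
  have S: "?P (Suc L) = ?P L * (1 - q ^ (2 * L + 2))" for L
    by (simp add: qpoch_Suc flip: power_mult power_add)
  have e: "(Suc L)\<^sup>2 + Suc L = L\<^sup>2 + L + (2 * L + 2)" for L
    by (simp add: power2_eq_square)
  {
    case base
    define t X where "t = (-1) ^ r * q ^ (r\<^sup>2 + r) * ?P r" and "X = q ^ (2 * r + 2)"
    have "q ^ (2 * (r + r + 1) + 2) = X * X"
      unfolding X_def power_add[symmetric] by (rule arg_cong[of _ _ "(^) q"]) simp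
    then have s: "?P (Suc r + Suc r) = ?P (r + r + 1) * (1 - X * X)"
      using S[of "r + r + 1"] by simp
    then have "1 - X * X \<noteq> 0" using P[of "Suc r + Suc r"] by auto
    then have "X * (t / ?P (r + r + 1)) = - (1 + X) * (- t * X * (1 - X)) / ?P (Suc r + Suc r)"
      unfolding s using P[of "r + r + 1"] by (simp add: divide_simps) (simp add: algebra_simps)
    moreover have "alt_tail q (Suc r) (Suc r) = 0" "alt_tail q (Suc r) r = t / ?P (r + r + 1)"
      by (simp_all add: alt_tail_def t_def)
    moreover have "(-1) ^ Suc r * q ^ ((Suc r)\<^sup>2 + Suc r) * ?P (Suc r) = - t * X * (1 - X)"
      unfolding e power_add[of q "r\<^sup>2 + r"] S t_def X_def by simp
    ultimately show ?case
      unfolding X_def[symmetric] by (simp add: mult.assoc)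
  next
    case (step L)
    then obtain d where L: "L = Suc r + d" using le_Suc_ex by blast
    define t where "t = (-1) ^ L * q ^ (L\<^sup>2 + L) * ?P L"
    define X Y where "X = q ^ (2 * r + 2)" and "Y = q ^ (2 * d + 2)"
    let ?D = "?P (Suc d) * ?P (L + Suc (Suc r))"
    have a1: "alt_tail q (Suc L) (Suc r) = alt_tail q L (Suc r) + t / (?P d * ?P (L + Suc (Suc r)))"
      using step by (simp add: alt_tail_def t_def L)
    have a2: "alt_tail q (Suc L) r = alt_tail q L r + t / (?P (Suc d) * ?P (L + Suc r))"
      using step by (simp add: alt_tail_def t_def L)
    have t': "(-1) ^ Suc L * q ^ ((Suc L)\<^sup>2 + Suc L) * ?P (Suc L) = - t * (X * Y) * (1 - X * Y)"
    proof -
      have "q ^ (2 * L + 2) = X * Y"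
        unfolding X_def Y_def power_add[symmetric] by (rule arg_cong[of _ _ "(^) q"]) (simp add: L)
      then show ?thesis unfolding e power_add[of q "L\<^sup>2 + L"] S t_def by simp
    qed
    have s1: "?P (Suc d) = ?P d * (1 - Y)" unfolding S Y_def ..
    have s2: "?P (L + Suc (Suc r)) = ?P (L + Suc r) * (1 - X * X * Y)"
    proof -
      have "q ^ (2 * (L + Suc r) + 2) = X * X * Y"
        unfolding X_def Y_def power_add[symmetric] by (rule arg_cong[of _ _ "(^) q"]) (simp add: L)
      then show ?thesis using S[of "L + Suc r"] by simp
    qed
    have nz': "1 - Y \<noteq> 0" "1 - X * X * Y \<noteq> 0"
      using P[of "Suc d"] P[of "L + Suc (Suc r)"] unfolding s1 s2 by auto
    have "alt_tail q (Suc L) (Suc r) + X * alt_tail q (Suc L) r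
        = (alt_tail q L (Suc r) + X * alt_tail q L r)
          + (t / (?P d * ?P (L + Suc (Suc r))) + X * (t / (?P (Suc d) * ?P (L + Suc r))))"
      unfolding a1 a2 by (simp add: algebra_simps)
    also have "alt_tail q L (Suc r) + X * alt_tail q L r = - (1 + X) * t / (?P d * ?P (L + Suc r))"
      using step.IH unfolding X_def t_def by (simp add: L mult.assoc)
    also have "- (1 + X) * t / (?P d * ?P (L + Suc r)) + (t / (?P d * ?P (L + Suc (Suc r))) + X * (t / (?P (Suc d) * ?P (L + Suc r))))
       = - (1 + X) * (- t * (X * Y) * (1 - X * Y)) / (?P (Suc d) * ?P (L + Suc (Suc r)))"
      unfolding s1 s2 using nz' P[of d] P[of "L + Suc r"]
      by (simp add: divide_simps) (simp add: algebra_simps)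
    finally show ?case unfolding t'[symmetric] X_def[symmetric] by (simp add: L mult.assoc)
  }
qed


text \<open>
  Solving the recurrence. The bracket separates the value \<open>1\<close> that survives for \<open>L \<rightarrow> \<infinity>\<close>, the term
  \<open>1 / (Q;Q)\<^sub>L\<close> that carries the pole at a root of unity, and a sum over \<open>j\<close> that stays regular there,
  because \<open>(Q;Q)\<^sub>L / (Q;Q)\<^sub>L\<^sub>+\<^sub>j\<close> and \<open>(Q;Q)\<^sub>L\<^sub>-\<^sub>j\<close> have no pole and no zero for \<open>0 < j < L = N\<close>.
\<close>

lemma alt_tail_closed:
  fixes q :: "'a::field"
  assumes nz: "\<And>k. 0 < k \<Longrightarrow> q ^ (2 * k) \<noteq> 1" and q0: "q \<noteq> 0"
    and r: "r \<le> L"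
  shows "(-1) ^ r * alt_tail q L r = q ^ (r\<^sup>2 + r) * (1 - (-1) ^ L * q ^ (L\<^sup>2 + L) *
       (1 / qfact (q\<^sup>2) L + (\<Sum>j=1..r. (-1) ^ j * (1 + q ^ (2 * j)) / q ^ (j\<^sup>2 + j) * qfact (q\<^sup>2) L
            / (qfact (q\<^sup>2) (L - j) * qfact (q\<^sup>2) (L + j)))))"
  using r
proof (induction r)
  case 0
  then show ?case by (simp add: alt_tail_0[OF nz])
next
  case (Suc r)
  let ?P = "qfact (q\<^sup>2)"
  let ?w = "\<lambda>j. (-1) ^ j * (1 + q ^ (2 * j)) / q ^ (j\<^sup>2 + j) * ?P L / (?P (L - j) * ?P (L + j))"
  define S where "S = 1 / ?P L + (\<Sum>j=1..r. ?w j)"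
  have e: "(Suc r)\<^sup>2 + Suc r = r\<^sup>2 + r + (2 * r + 2)"
    by (simp add: power2_eq_square)
  have "(-1) ^ Suc r * alt_tail q L (Suc r)
      = q ^ (2 * r + 2) * ((-1) ^ r * alt_tail q L r)
        + (-1) ^ Suc r * (alt_tail q L (Suc r) + q ^ (2 * r + 2) * alt_tail q L r)"
    by (simp add: algebra_simps)
  also have "(-1) ^ r * alt_tail q L r = q ^ (r\<^sup>2 + r) * (1 - (-1) ^ L * q ^ (L\<^sup>2 + L) * S)"
    using Suc by (simp add: S_def)
  also have "(-1) ^ Suc r * (alt_tail q L (Suc r) + q ^ (2 * r + 2) * alt_tail q L r)
     = - (q ^ ((Suc r)\<^sup>2 + Suc r) * ((-1) ^ L * q ^ (L\<^sup>2 + L) * ?w (Suc r)))"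
    using q0 by (subst alt_tail_Suc[OF nz Suc.prems]) (simp_all add: e mult_ac del: minus_add_distrib)
  also have "q ^ (2 * r + 2) * (q ^ (r\<^sup>2 + r) * (1 - (-1) ^ L * q ^ (L\<^sup>2 + L) * S))
     = q ^ ((Suc r)\<^sup>2 + Suc r) * (1 - (-1) ^ L * q ^ (L\<^sup>2 + L) * S)"
    unfolding e power_add[of q "r\<^sup>2 + r"] by (simp only: mult_ac)
  also have "q ^ ((Suc r)\<^sup>2 + Suc r) * (1 - (-1) ^ L * q ^ (L\<^sup>2 + L) * S)
       + - (q ^ ((Suc r)\<^sup>2 + Suc r) * ((-1) ^ L * q ^ (L\<^sup>2 + L) * ?w (Suc r)))
     = q ^ ((Suc r)\<^sup>2 + Suc r) * (1 - (-1) ^ L * q ^ (L\<^sup>2 + L) * (S + ?w (Suc r)))"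
    by (simp only: algebra_simps) simp
  also have "S + ?w (Suc r) = 1 / ?P L + (\<Sum>j=1..Suc r. ?w j)"
    unfolding S_def by simp
  finally show ?case .
qed

section \<open>Collapsing the multiple sum\<close>

lemma poly_qpoch_X: "poly (qpoch ([:0, 1:]\<^sup>2) ([:0, 1:]\<^sup>2) n) q = qfact (q\<^sup>2) (n :: nat)"
  for q :: complex
  by (simp add: qpoch_def poly_prod)

lemma poly_gauss_poly:
  assumes nz: "\<And>k. 0 < k \<Longrightarrow> q ^ (2 * k) \<noteq> 1"
  shows "poly (gauss_poly n k) q =
    (if k \<le> n then qfact (q\<^sup>2) n / (qfact (q\<^sup>2) (n - k) * qfact (q\<^sup>2) k) else 0)"
proof (cases "k \<le> n")
  case True
  have P: "qfact (q\<^sup>2) k \<noteq> 0" for k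
    using nz by (intro qfact_nonzero) (auto simp flip: power_mult)
  have "poly (gauss_poly n k) q * (qfact (q\<^sup>2) (n - k) * qfact (q\<^sup>2) k) = qfact (q\<^sup>2) n"
    using arg_cong[OF gauss_poly_mult[OF True], of "\<lambda>p. poly p q"]
    by (simp add: poly_qpoch_X)
  then show ?thesis using True P by (simp add: eq_divide_eq)
next
  case False
  then show ?thesis by (simp add: gauss_poly_def)
qed

text \<open>
  The summand without the factors that depend on the last index \<open>n (k + 1)\<close> alone, so that the
  sum over the remaining indices can be treated by induction on \<open>k\<close>. The last Gaussian polynomial
  still involves \<open>n (k + 1)\<close>.
\<close>

definition chain_weight :: "complex \<Rightarrow> nat \<Rightarrow> (nat \<Rightarrow> nat) \<Rightarrow> complex" where
  "chain_weight q k n = qpoch q (q\<^sup>2) (n 1) / qpoch (-q) q (2 * n 1 + 1)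
     * (\<Prod>i=1..k. q ^ (2 * (n i)\<^sup>2 + 2 * n i) * poly (gauss_poly (n (i + 1)) (n i)) q)"

lemma summand_eq:
  assumes "m = k + 2"
  shows "summand m q n = (-1) ^ n (k + 1) * q ^ ((n (k + 1))\<^sup>2 + n (k + 1)) * chain_weight q k n"
proof -
  have "2 * ((j + 1) choose 2) = j\<^sup>2 + j" for j :: nat
    by (simp add: choose_two power2_eq_square)
  then show ?thesis
    using assms by (simp add: summand_def chain_weight_def prod.distrib power_add power_sum mult_ac)
qed

text \<open>
  One index is one step of the chain. The weight \<open>\<phi>\<close> of the last index is arbitrary because the
  induction step uses the hypothesis with the Gaussian polynomial that links the last two indices
  as part of \<open>\<phi>\<close>. Every index may be cut off at the same \<open>L\<close>, since the Gaussian polynomials vanish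
  unless the indices increase weakly.
\<close>

lemma sum_chain_weight:
  assumes nz: "\<And>k. 0 < k \<Longrightarrow> q ^ (2 * k) \<noteq> 1"
  shows "(\<Sum>n\<in>{1..k+1} \<rightarrow>\<^sub>E {0..<L}. \<phi> (n (k + 1)) * chain_weight q k n)
       = (\<Sum>j<L. \<phi> j * qfact (q\<^sup>2) j * (\<Sum>r\<le>j. (-1) ^ r * q ^ (r\<^sup>2 + k * (2 * r\<^sup>2 + 2 * r)) * (1 - q ^ (2 * r + 1))
            / (qfact (q\<^sup>2) (j - r) * qfact (q\<^sup>2) (j + r + 1))))"
proof (induction k arbitrary: \<phi>)
  case 0
  have "(\<Sum>n\<in>{1..0+1} \<rightarrow>\<^sub>E {0..<L}. \<phi> (n (0 + 1)) * chain_weight q 0 n)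
     = (\<Sum>j<L. \<phi> j * (qpoch q (q\<^sup>2) j / qpoch (-q) q (2 * j + 1)))"
    by (rule sum.reindex_bij_witness[of _ "\<lambda>j. \<lambda>i\<in>{1}. j" "\<lambda>n. n 1"])
       (auto simp: chain_weight_def PiE_def extensional_def fun_eq_iff)
  also have "\<dots> = (\<Sum>j<L. \<phi> j * qfact (q\<^sup>2) j * (qpoch q (q\<^sup>2) j / (qpoch (-q) q (2 * j + 1) * qfact (q\<^sup>2) j)))"
  proof (rule sum.cong)
    fix j
    have "qfact (q\<^sup>2) j \<noteq> 0"
      using nz by (intro qfact_nonzero) (auto simp flip: power_mult)
    then show "\<phi> j * (qpoch q (q\<^sup>2) j / qpoch (-q) q (2 * j + 1))
      = \<phi> j * qfact (q\<^sup>2) j * (qpoch q (q\<^sup>2) j / (qpoch (-q) q (2 * j + 1) * qfact (q\<^sup>2) j))"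
      by simp
  qed simp
  finally show ?case
    by (simp only: seed_bailey_pair[of q, OF nz] mult_zero_left add_0_right)
next
  case (Suc k)
  let ?P = "qfact (q\<^sup>2)"
  have P: "?P k \<noteq> 0" for k
    using nz by (intro qfact_nonzero) (auto simp flip: power_mult)
  let ?g = "\<lambda>j r. (-1) ^ r * q ^ (r\<^sup>2 + k * (2 * r\<^sup>2 + 2 * r)) * (1 - q ^ (2 * r + 1)) / (?P (j - r) * ?P (j + r + 1))"
  let ?ext = "\<lambda>(x, n). n(k + 2 := x)"
  have ins: "{1..Suc k + 1} = insert (k + 2) {1..k + 1}" by auto
  have "(\<Sum>n\<in>{1..Suc k + 1} \<rightarrow>\<^sub>E {0..<L}. \<phi> (n (Suc k + 1)) * chain_weight q (Suc k) n)
      = (\<Sum>(x, n)\<in>{0..<L} \<times> ({1..k + 1} \<rightarrow>\<^sub>E {0..<L}). \<phi> x * chain_weight q (Suc k) (n(k + 2 := x)))"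
    unfolding ins PiE_insert_eq
    using inj_combinator[of "k + 2" "{1..k + 1}" "\<lambda>_. {0..<L}"]
    by (subst sum.reindex) (simp_all add: case_prod_unfold)
  also have "\<dots> = (\<Sum>x<L. \<phi> x * (\<Sum>n\<in>{1..k + 1} \<rightarrow>\<^sub>E {0..<L}.
       q ^ (2 * (n (k + 1))\<^sup>2 + 2 * n (k + 1)) * poly (gauss_poly x (n (k + 1))) q * chain_weight q k n))"
    unfolding sum.cartesian_product[symmetric] sum_distrib_left atLeast0LessThan
  proof (intro sum.cong refl)
    fix x n
    have "(\<Prod>i=1..k. q ^ (2 * ((n(k + 2 := x)) i)\<^sup>2 + 2 * (n(k + 2 := x)) i) * poly (gauss_poly ((n(k + 2 := x)) (i + 1)) ((n(k + 2 := x)) i)) q)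
      = (\<Prod>i=1..k. q ^ (2 * (n i)\<^sup>2 + 2 * n i) * poly (gauss_poly (n (i + 1)) (n i)) q)"
      by (intro prod.cong) auto
    then show "\<phi> x * chain_weight q (Suc k) (n(k + 2 := x)) =
      \<phi> x * (q ^ (2 * (n (k + 1))\<^sup>2 + 2 * n (k + 1)) * poly (gauss_poly x (n (k + 1))) q * chain_weight q k n)"
      by (simp add: chain_weight_def mult_ac)
  qed
  also have "\<dots> = (\<Sum>x<L. \<phi> x * (\<Sum>j<L. q ^ (2 * j\<^sup>2 + 2 * j) * poly (gauss_poly x j) q * ?P j * (\<Sum>r\<le>j. ?g j r)))"
    by (subst Suc.IH[of "\<lambda>j. q ^ (2 * j\<^sup>2 + 2 * j) * poly (gauss_poly _ j) q"]) simp
  also have "\<dots> = (\<Sum>x<L. \<phi> x * ?P x * (\<Sum>j\<le>x. (q\<^sup>2) ^ (j\<^sup>2 + j) / ?P (x - j) * (\<Sum>r\<le>j. ?g j r)))"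
  proof (intro sum.cong refl)
    fix x assume x: "x \<in> {..<L}"
    have "(\<Sum>j<L. q ^ (2 * j\<^sup>2 + 2 * j) * poly (gauss_poly x j) q * ?P j * (\<Sum>r\<le>j. ?g j r))
       = (\<Sum>j\<le>x. q ^ (2 * j\<^sup>2 + 2 * j) * poly (gauss_poly x j) q * ?P j * (\<Sum>r\<le>j. ?g j r))"
      using x by (intro sum.mono_neutral_right) (auto simp: gauss_poly_def)
    also have "\<dots> = (\<Sum>j\<le>x. ?P x * ((q\<^sup>2) ^ (j\<^sup>2 + j) / ?P (x - j) * (\<Sum>r\<le>j. ?g j r)))"
    proof (intro sum.cong refl)
      fix j assume "j \<in> {..x}"
      then have "poly (gauss_poly x j) q * ?P j = ?P x / ?P (x - j)"
        using P[of j] by (simp add: poly_gauss_poly[OF nz])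
      moreover have "q ^ (2 * j\<^sup>2 + 2 * j) = (q\<^sup>2) ^ (j\<^sup>2 + j)"
        by (simp flip: power_mult add: distrib_left)
      ultimately show "q ^ (2 * j\<^sup>2 + 2 * j) * poly (gauss_poly x j) q * ?P j * (\<Sum>r\<le>j. ?g j r)
          = ?P x * ((q\<^sup>2) ^ (j\<^sup>2 + j) / ?P (x - j) * (\<Sum>r\<le>j. ?g j r))"
        by (simp add: mult.assoc) 
    qed
    finally show "\<phi> x * (\<Sum>j<L. q ^ (2 * j\<^sup>2 + 2 * j) * poly (gauss_poly x j) q * ?P j * (\<Sum>r\<le>j. ?g j r))
      = \<phi> x * ?P x * (\<Sum>j\<le>x. (q\<^sup>2) ^ (j\<^sup>2 + j) / ?P (x - j) * (\<Sum>r\<le>j. ?g j r))"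
      by (simp add: sum_distrib_left mult.assoc)
  qed
  also have "\<dots> = (\<Sum>x<L. \<phi> x * ?P x * (\<Sum>r\<le>x. (q\<^sup>2) ^ (r\<^sup>2 + r) * ((-1) ^ r * q ^ (r\<^sup>2 + k * (2 * r\<^sup>2 + 2 * r)) * (1 - q ^ (2 * r + 1)))
       / (?P (x - r) * ?P (x + r + 1))))"
    using nz by (subst bailey_pair_chain) (auto simp flip: power_mult)
  also have "\<dots> = (\<Sum>x<L. \<phi> x * ?P x * (\<Sum>r\<le>x. (-1) ^ r * q ^ (r\<^sup>2 + Suc k * (2 * r\<^sup>2 + 2 * r)) * (1 - q ^ (2 * r + 1))
       / (?P (x - r) * ?P (x + r + 1))))"
  proof -
    have "(q\<^sup>2) ^ (r\<^sup>2 + r) * ((-1) ^ r * q ^ (r\<^sup>2 + k * (2 * r\<^sup>2 + 2 * r)) * (1 - q ^ (2 * r + 1)))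
       = (-1) ^ r * q ^ (r\<^sup>2 + Suc k * (2 * r\<^sup>2 + 2 * r)) * (1 - q ^ (2 * r + 1))" for r
    proof -
      have "r\<^sup>2 + Suc k * (2 * r\<^sup>2 + 2 * r) = 2 * (r\<^sup>2 + r) + (r\<^sup>2 + k * (2 * r\<^sup>2 + 2 * r))" by simp
      then have "q ^ (r\<^sup>2 + Suc k * (2 * r\<^sup>2 + 2 * r)) = (q\<^sup>2) ^ (r\<^sup>2 + r) * q ^ (r\<^sup>2 + k * (2 * r\<^sup>2 + 2 * r))"
        by (simp only: power_add power_mult)
      then show ?thesis by (simp only: mult_ac)
    qed
    then show ?thesis by (simp only:)
  qed
  finally show ?case .
qed

lemma U_eq_alt_tail:
  assumes nz: "\<And>k. 0 < k \<Longrightarrow> q ^ (2 * k) \<noteq> 1" and m: "m \<ge> 2"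
  shows "U m L q = (\<Sum>r<L. q ^ (r\<^sup>2 + (m - 2) * (2 * r\<^sup>2 + 2 * r)) * (1 - q ^ (2 * r + 1)) * ((-1) ^ r * alt_tail q L r))"
proof -
  let ?P = "qfact (q\<^sup>2)"
  define k where "k = m - 2"
  have mk: "m = k + 2" using m by (simp add: k_def)
  define a where "a = (\<lambda>r. (-1) ^ r * q ^ (r\<^sup>2 + k * (2 * r\<^sup>2 + 2 * r)) * (1 - q ^ (2 * r + 1)))"
  define t where "t = (\<lambda>n. (-1) ^ n * q ^ (n\<^sup>2 + n) * ?P n)"
  have "U m L q = (\<Sum>n\<in>{1..k+1} \<rightarrow>\<^sub>E {0..<L}. ((-1) ^ n (k + 1) * q ^ ((n (k + 1))\<^sup>2 + n (k + 1))) * chain_weight q k n)"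
    unfolding U_def summand_eq[OF mk] by (simp add: mk)
  also have "\<dots> = (\<Sum>n<L. t n * (\<Sum>r\<le>n. a r / (?P (n - r) * ?P (n + r + 1))))"
    by (subst sum_chain_weight[OF nz, where \<phi> = "\<lambda>n. (-1) ^ n * q ^ (n\<^sup>2 + n)"]) (simp_all add: t_def a_def)
  also have "\<dots> = (\<Sum>r<L. \<Sum>n\<in>{r..<L}. a r * (t n / (?P (n - r) * ?P (n + r + 1))))"
    unfolding sum_distrib_left
    by (subst (1 2) sum.Sigma) (auto intro!: sum.reindex_bij_witness[of _ prod.swap prod.swap])
  also have "\<dots> = (\<Sum>r<L. a r * alt_tail q L r)"
    by (simp add: alt_tail_def t_def sum_distrib_left)
  finally show ?thesis
    by (simp add: a_def k_def mult_ac)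
qed

section \<open>The theta series inside the unit disk\<close>

lemma qpoch_Bseq:
  fixes x q :: complex
  assumes q: "norm q < 1" and nz: "\<And>n. x * q ^ n \<noteq> 1"
  shows "Bseq (qpoch x q)" "Bseq (\<lambda>n. inverse (qpoch x q n))"
proof -
  have "summable (\<lambda>n. norm (1 - x * q ^ n - 1))"
    using q by (simp add: norm_mult norm_power summable_mult)
  then have "convergent_prod (\<lambda>n. 1 - x * q ^ n)"
    by (intro abs_convergent_prod_imp_convergent_prod summable_imp_abs_convergent_prod)
  moreover have "1 - x * q ^ n \<noteq> 0" for n
    using nz[of n] by auto
  ultimately obtain p where p: "p \<noteq> 0" "(\<lambda>n. \<Prod>j<n. 1 - x * q ^ j) \<longlonglongrightarrow> p"
    using convergent_prod_iff_nz_lim by (metis LIMSEQ_lessThan_iff_atMost)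
  then have lim: "qpoch x q \<longlonglongrightarrow> p"
    by (simp add: qpoch_def[abs_def])
  show "Bseq (qpoch x q)"
    using lim convergentI by (intro convergent_imp_Bseq)
  show "Bseq (\<lambda>n. inverse (qpoch x q n))"
    using tendsto_inverse[OF lim p(1)] convergentI by (intro convergent_imp_Bseq)
qed

text \<open>
  This connects the unordered sum over all multi-indices with the truncations \<open>U m L q\<close>.
\<close>

lemma filterlim_PiE_boxes:
  fixes I :: "'i set"
  assumes "finite I"
  shows "filterlim (\<lambda>L. I \<rightarrow>\<^sub>E {0..<L :: nat}) (finite_subsets_at_top (I \<rightarrow>\<^sub>E UNIV)) sequentially"
  unfolding filterlim_finite_subsets_at_top
proof (intro allI impI)
  fix X :: "('i \<Rightarrow> nat) set" assume X: "finite X \<and> X \<subseteq> I \<rightarrow>\<^sub>E UNIV"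
  define L0 where "L0 = Suc (\<Sum>n\<in>X. \<Sum>i\<in>I. n i)"
  have "n i < L0" if "n \<in> X" "i \<in> I" for n i
  proof -
    have "n i \<le> (\<Sum>i\<in>I. n i)" using assms that by (intro member_le_sum) auto
    also have "\<dots> \<le> (\<Sum>n\<in>X. \<Sum>i\<in>I. n i)" using X that by (intro member_le_sum[of n X]) auto
    finally show ?thesis by (simp add: L0_def)
  qed
  then have "X \<subseteq> I \<rightarrow>\<^sub>E {0..<L}" if "L0 \<le> L" for L
    using X that by (auto simp: PiE_iff subset_iff) (meson less_le_trans)
  moreover have "finite (I \<rightarrow>\<^sub>E {0..<L})" for L :: nat
    by (rule finite_PiE[OF assms]) simp
  moreover have "I \<rightarrow>\<^sub>E {0..<L} \<subseteq> I \<rightarrow>\<^sub>E UNIV" for L :: nat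
    by (rule PiE_mono) simp
  ultimately show "\<forall>\<^sub>F L in sequentially. finite (I \<rightarrow>\<^sub>E {0..<L}) \<and> X \<subseteq> I \<rightarrow>\<^sub>E {0..<L} \<and> I \<rightarrow>\<^sub>E {0..<L} \<subseteq> I \<rightarrow>\<^sub>E UNIV"
    unfolding eventually_sequentially by blast
qed

lemma summable_on_prod_powers:
  fixes I :: "'i set" and \<rho> :: real
  assumes "finite I" and \<rho>: "0 \<le> \<rho>" "\<rho> < 1"
  shows "(\<lambda>n. \<Prod>i\<in>I. \<rho> ^ n i) summable_on (I \<rightarrow>\<^sub>E UNIV)"
proof (rule nonneg_bounded_partial_sums_imp_summable_on)
  show "\<forall>\<^sub>F X in finite_subsets_at_top (I \<rightarrow>\<^sub>E UNIV). (\<Sum>n\<in>X. \<Prod>i\<in>I. \<rho> ^ n i) \<le> (1 / (1 - \<rho>)) ^ card I"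
  proof (rule eventually_finite_subsets_at_top_weakI)
    fix X :: "('i \<Rightarrow> nat) set" assume X: "finite X" "X \<subseteq> I \<rightarrow>\<^sub>E UNIV"
    have "\<forall>\<^sub>F L in sequentially. finite (I \<rightarrow>\<^sub>E {0..<L}) \<and> X \<subseteq> I \<rightarrow>\<^sub>E {0..<L} \<and> I \<rightarrow>\<^sub>E {0..<L} \<subseteq> I \<rightarrow>\<^sub>E UNIV"
      using filterlim_PiE_boxes[OF assms(1)] X unfolding filterlim_finite_subsets_at_top by blast
    from eventually_happens'[OF sequentially_bot this]
    obtain L where L: "X \<subseteq> I \<rightarrow>\<^sub>E {0..<L}"
      by (elim exE conjE)
    have "(\<Sum>n\<in>X. \<Prod>i\<in>I. \<rho> ^ n i) \<le> (\<Sum>n\<in>I \<rightarrow>\<^sub>E {0..<L}. \<Prod>i\<in>I. \<rho> ^ n i)"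
      using L \<rho> by (intro sum_mono2 finite_PiE[OF assms(1)] prod_nonneg ballI zero_le_power) simp_all
    also have "\<dots> = (\<Prod>i\<in>I. \<Sum>j\<in>{0..<L}. \<rho> ^ j)"
      by (rule prod_sum_PiE[OF assms(1), symmetric]) simp
    also have "\<dots> \<le> (\<Prod>i\<in>I. 1 / (1 - \<rho>))"
    proof (rule prod_mono)
      fix i
      have "(\<Sum>j\<in>{0..<L}. \<rho> ^ j) \<le> (\<Sum>j. \<rho> ^ j)"
        using \<rho> by (intro sum_le_suminf) auto
      then show "0 \<le> (\<Sum>j\<in>{0..<L}. \<rho> ^ j) \<and> (\<Sum>j\<in>{0..<L}. \<rho> ^ j) \<le> 1 / (1 - \<rho>)"
        using \<rho> by (simp add: suminf_geometric sum_nonneg)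
    qed
    finally show "(\<Sum>n\<in>X. \<Prod>i\<in>I. \<rho> ^ n i) \<le> (1 / (1 - \<rho>)) ^ card I"
      by simp
  qed
  show "0 \<le> (\<Prod>i\<in>I. \<rho> ^ n i)" for n
    using \<rho> by (intro prod_nonneg ballI zero_le_power)
qed

lemma power_neq_one_of_norm_less:
  fixes q :: complex
  assumes "norm q < 1" "0 < k"
  shows "q ^ k \<noteq> 1"
proof
  assume "q ^ k = 1"
  then have "norm q ^ k = 1" by (metis norm_one norm_power)
  then show False using assms power_less_one_iff[of "norm q" k] by simp
qed

lemma qpoch_bounds:
  fixes x q :: complex
  assumes q: "norm q < 1" and nz: "\<And>n. x * q ^ n \<noteq> 1"
  obtains C where "C > 0" "\<And>n. norm (qpoch x q n) \<le> C" "\<And>n. norm (inverse (qpoch x q n)) \<le> C"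
proof -
  obtain C1 C2 where C: "0 < C1" "\<And>n. norm (qpoch x q n) \<le> C1" "0 < C2" "\<And>n. norm (inverse (qpoch x q n)) \<le> C2"
    using qpoch_Bseq[OF q nz] unfolding Bseq_def by metis
  show ?thesis
    by (rule that[of "max C1 C2"]) (use C in \<open>auto simp: le_max_iff_disj\<close>)
qed

lemma qfact_bounds:
  fixes q :: complex
  assumes "norm q < 1"
  obtains C where "C > 0" "\<And>n. norm (qfact (q\<^sup>2) n) \<le> C" "\<And>n. norm (inverse (qfact (q\<^sup>2) n)) \<le> C"
proof (rule qpoch_bounds)
  show "norm (q\<^sup>2) < 1"
    using assms by (simp add: norm_power power_less_one_iff)
  show "q\<^sup>2 * (q\<^sup>2) ^ n \<noteq> 1" for n
    using power_neq_one_of_norm_less[OF assms, of "2 + 2 * n"] by (simp only: power_add power_mult not_False_eq_True)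
qed (use that in blast)

text \<open>
  All \<open>q\<close>-factorials and their inverses are bounded, so the Gaussian powers alone decide
  convergence; a geometric majorant in each index suffices.
\<close>

lemma summand_bound:
  fixes q :: complex
  assumes q: "norm q < 1" and m: "m \<ge> 2"
  obtains K where "\<And>n. norm (summand m q n) \<le> K * (\<Prod>i\<in>{1..m-1}. norm q ^ n i)"
proof -
  define k where "k = m - 2"
  have mk: "m = k + 2" using m by (simp add: k_def)
  have nz: "q ^ (2 * j) \<noteq> 1" if "0 < j" for j
    using power_neq_one_of_norm_less[OF q] that by simp
  obtain C where C: "C > 0" "\<And>n. norm (qfact (q\<^sup>2) n) \<le> C" "\<And>n. norm (inverse (qfact (q\<^sup>2) n)) \<le> C"
    by (rule qfact_bounds[OF q]) blast
  have q2: "norm (q\<^sup>2) < 1"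
    using q by (simp add: norm_power power_less_one_iff)
  have "q * (q\<^sup>2) ^ n \<noteq> 1" for n
    using power_neq_one_of_norm_less[OF q, of "1 + 2 * n"] by (simp only: power_add power_mult power_one_right not_False_eq_True)
  then obtain C1 where C1: "C1 > 0" "\<And>n. norm (qpoch q (q\<^sup>2) n) \<le> C1"
    using qpoch_bounds[OF q2, of q] by metis
  have "- q * q ^ n \<noteq> 1" for n
  proof
    assume "- q * q ^ n = 1"
    then have "norm (q ^ Suc n) = 1" by (metis norm_minus_cancel norm_one minus_mult_left power_Suc)
    then show False using q power_less_one_iff[of "norm q" "Suc n"] by (simp add: norm_power del: power_Suc)
  qed
  then obtain C2 where C2: "C2 > 0" "\<And>n. norm (inverse (qpoch (-q) q n)) \<le> C2"
    using qpoch_bounds[OF q, of "-q"] by metis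
  have gauss: "norm (poly (gauss_poly a b) q) \<le> C * (C * C)" for a b
  proof (cases "b \<le> a")
    case True
    then have "norm (poly (gauss_poly a b) q) =
        norm (qfact (q\<^sup>2) a) * (norm (inverse (qfact (q\<^sup>2) (a - b))) * norm (inverse (qfact (q\<^sup>2) b)))"
      by (simp add: poly_gauss_poly[OF nz] norm_mult norm_divide norm_inverse field_simps)
    also have "\<dots> \<le> C * (C * C)"
      using C by (intro mult_mono) (auto intro: mult_nonneg_nonneg)
    finally show ?thesis .
  next
    case False
    then show ?thesis using C(1) by (simp add: gauss_poly_def)
  qed
  have pw: "norm q ^ a \<le> norm q ^ b" if "b \<le> a" for a b
    using q that by (intro power_decreasing) auto
  have "norm (summand m q n) \<le> C1 * C2 * (C * (C * C)) ^ k * (\<Prod>i\<in>{1..m-1}. norm q ^ n i)" for n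
  proof -
    have "norm (summand m q n) = norm q ^ ((n (k + 1))\<^sup>2 + n (k + 1)) *
        ((norm (qpoch q (q\<^sup>2) (n 1)) * norm (inverse (qpoch (-q) q (2 * n 1 + 1))))
         * (\<Prod>i=1..k. norm q ^ (2 * (n i)\<^sup>2 + 2 * n i) * norm (poly (gauss_poly (n (i + 1)) (n i)) q)))"
      unfolding summand_eq[OF mk] chain_weight_def
      by (simp add: norm_mult norm_power norm_divide norm_inverse divide_inverse flip: prod_norm)
    also have "\<dots> \<le> norm q ^ n (k + 1) * ((C1 * C2) * (\<Prod>i=1..k. norm q ^ n i * (C * (C * C))))"
      using C(1) C1 C2 gauss by (intro mult_mono prod_mono pw conjI prod_nonneg mult_nonneg_nonneg) auto
    also have "\<dots> = C1 * C2 * (C * (C * C)) ^ k * ((\<Prod>i=1..k. norm q ^ n i) * norm q ^ n (k + 1))"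
      by (simp add: prod.distrib)
    also have "(\<Prod>i=1..k. norm q ^ n i) * norm q ^ n (k + 1) = (\<Prod>i\<in>{1..m-1}. norm q ^ n i)"
      by (simp add: mk)
    finally show ?thesis .
  qed
  then show ?thesis using that by blast
qed

lemma U_tendsto_infsum:
  fixes q :: complex
  assumes q: "norm q < 1" and m: "m \<ge> 2"
  shows "(\<lambda>L. U m L q) \<longlonglongrightarrow> (\<Sum>\<^sub>\<infinity>n\<in>({1..m-1} \<rightarrow>\<^sub>E UNIV). summand m q n)"
proof -
  obtain K where K: "\<And>n. norm (summand m q n) \<le> K * (\<Prod>i\<in>{1..m-1}. norm q ^ n i)"
    by (rule summand_bound[OF assms]) blast
  have "(\<lambda>n. K * (\<Prod>i\<in>{1..m-1}. norm q ^ n i)) summable_on ({1..m-1} \<rightarrow>\<^sub>E UNIV)"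
    using q by (intro summable_on_cmult_right summable_on_prod_powers finite_atLeastAtMost norm_ge_zero)
  then have "(\<lambda>n. norm (summand m q n)) summable_on ({1..m-1} \<rightarrow>\<^sub>E UNIV)"
    by (rule summable_on_comparison_test) (rule K norm_ge_zero)+
  then have "summand m q summable_on ({1..m-1} \<rightarrow>\<^sub>E UNIV)"
    by (rule abs_summable_summable)
  then have "(sum (summand m q) \<longlongrightarrow> (\<Sum>\<^sub>\<infinity>n\<in>({1..m-1} \<rightarrow>\<^sub>E UNIV). summand m q n)) (finite_subsets_at_top ({1..m-1} \<rightarrow>\<^sub>E UNIV))"
    by (rule infsum_tendsto)
  from filterlim_compose[OF this filterlim_PiE_boxes[of "{1..m-1}"]]
  show ?thesis by (simp add: U_def)
qed

lemma alt_tail_tendsto: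
  fixes q :: complex
  assumes q: "norm q < 1" "q \<noteq> 0"
  shows "(\<lambda>L. (-1) ^ r * alt_tail q L r) \<longlonglongrightarrow> q ^ (r\<^sup>2 + r)"
proof -
  let ?P = "qfact (q\<^sup>2)"
  have nz: "q ^ (2 * j) \<noteq> 1" if "0 < j" for j
    using power_neq_one_of_norm_less[OF q(1)] that by simp
  obtain C where C: "C > 0" "\<And>n. norm (?P n) \<le> C" "\<And>n. norm (inverse (?P n)) \<le> C"
    by (rule qfact_bounds[OF q(1)]) blast
  have small: "(\<lambda>L. (-1) ^ L * q ^ (L\<^sup>2 + L)) \<longlonglongrightarrow> 0"
  proof (rule Lim_null_comparison)
    show "(\<lambda>L. norm q ^ L) \<longlonglongrightarrow> 0"
      using q by (intro LIMSEQ_power_zero) auto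
    show "\<forall>\<^sub>F L in sequentially. norm ((-1) ^ L * q ^ (L\<^sup>2 + L)) \<le> norm q ^ L"
      using q by (intro always_eventually allI) (simp add: norm_mult norm_power power_decreasing)
  qed
  define B where "B = (\<lambda>L. 1 / ?P L + (\<Sum>j=1..r. (-1) ^ j * (1 + q ^ (2 * j)) / q ^ (j\<^sup>2 + j) * ?P L / (?P (L - j) * ?P (L + j))))"
  define K where "K = C + (\<Sum>j=1..r. norm ((-1) ^ j * (1 + q ^ (2 * j)) / q ^ (j\<^sup>2 + j)) * (C * (C * C)))"
  have B: "norm (B L) \<le> K" for L
    unfolding B_def K_def
  proof (intro norm_triangle_le add_mono order.trans[OF norm_sum] sum_mono)
    show "norm (1 / ?P L) \<le> C" using C(3)[of L] by (simp add: inverse_eq_divide)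
    fix j
    let ?c = "(-1) ^ j * (1 + q ^ (2 * j)) / q ^ (j\<^sup>2 + j)"
    have "norm (?c * ?P L / (?P (L - j) * ?P (L + j)))
       = norm ?c * (norm (?P L) * (norm (inverse (?P (L - j))) * norm (inverse (?P (L + j)))))"
      by (simp add: norm_mult norm_divide norm_inverse divide_inverse)
    also have "\<dots> \<le> norm ?c * (C * (C * C))"
      using C by (intro mult_left_mono mult_mono) (auto intro: mult_nonneg_nonneg)
    finally show "norm (?c * ?P L / (?P (L - j) * ?P (L + j))) \<le> norm ?c * (C * (C * C))" .
  qed
  have "(\<lambda>L. (-1) ^ L * q ^ (L\<^sup>2 + L) * B L) \<longlonglongrightarrow> 0"
  proof (rule Lim_null_comparison)
    show "(\<lambda>L. norm ((-1) ^ L * q ^ (L\<^sup>2 + L)) * K) \<longlonglongrightarrow> 0"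
      using tendsto_norm_zero[OF small] by (rule tendsto_mult_left_zero)
    show "\<forall>\<^sub>F L in sequentially. norm ((-1) ^ L * q ^ (L\<^sup>2 + L) * B L) \<le> norm ((-1) ^ L * q ^ (L\<^sup>2 + L)) * K"
      using B by (intro always_eventually allI) (simp only: norm_mult mult_left_mono norm_ge_zero mult_nonneg_nonneg)
  qed
  then have "(\<lambda>L. q ^ (r\<^sup>2 + r) * (1 - (-1) ^ L * q ^ (L\<^sup>2 + L) * B L)) \<longlonglongrightarrow> q ^ (r\<^sup>2 + r) * (1 - 0)"
    by (intro tendsto_intros)
  moreover have "\<forall>\<^sub>F L in sequentially. q ^ (r\<^sup>2 + r) * (1 - (-1) ^ L * q ^ (L\<^sup>2 + L) * B L) = (-1) ^ r * alt_tail q L r"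
    using eventually_ge_at_top[of r]
    by eventually_elim (unfold B_def, rule alt_tail_closed[OF nz q(2), symmetric])
  ultimately show ?thesis
    using Lim_transform_eventually by force
qed

lemma alt_tail_bounded:
  fixes q :: complex
  assumes q: "norm q < 1"
  obtains K where "\<And>L r. norm (alt_tail q L r) \<le> K"
proof -
  let ?P = "qfact (q\<^sup>2)"
  obtain C where C: "C > 0" "\<And>n. norm (?P n) \<le> C" "\<And>n. norm (inverse (?P n)) \<le> C"
    by (rule qfact_bounds[OF q(1)]) blast
  have "norm (alt_tail q L r) \<le> (\<Sum>n. norm q ^ n * (C * (C * C)))" for L r
  proof -
    have "norm (alt_tail q L r) \<le> (\<Sum>n\<in>{r..<L}. norm q ^ n * (C * (C * C)))"
      unfolding alt_tail_def
    proof (intro order.trans[OF norm_sum] sum_mono)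
      fix n
      have "norm ((-1) ^ n * q ^ (n\<^sup>2 + n) * ?P n / (?P (n - r) * ?P (n + r + 1)))
         = norm q ^ (n\<^sup>2 + n) * (norm (?P n) * (norm (inverse (?P (n - r))) * norm (inverse (?P (n + r + 1)))))"
        by (simp add: norm_mult norm_divide norm_inverse norm_power divide_inverse)
      also have "\<dots> \<le> norm q ^ n * (C * (C * C))"
        using C q by (intro mult_mono power_decreasing) (auto intro: mult_nonneg_nonneg)
      finally show "norm ((-1) ^ n * q ^ (n\<^sup>2 + n) * ?P n / (?P (n - r) * ?P (n + r + 1))) \<le> norm q ^ n * (C * (C * C))" .
    qed
    also have "\<dots> \<le> (\<Sum>n. norm q ^ n * (C * (C * C)))"
      using q C(1) by (intro sum_le_suminf summable_mult2 summable_geometric) auto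
    finally show ?thesis .
  qed
  then show ?thesis using that by blast
qed

lemma theta_term_eq:
  fixes q :: "'a::comm_ring_1"
  assumes m: "m \<ge> 2"
  shows "q ^ (r\<^sup>2 + (m - 2) * (2 * r\<^sup>2 + 2 * r)) * (1 - q ^ (2 * r + 1)) * q ^ (r\<^sup>2 + r)
       = q ^ ((2 * m - 2) * r\<^sup>2 + (2 * m - 3) * r) * (1 - q ^ (2 * r + 1))"
proof -
  obtain k where "m = k + 2" using m le_Suc_ex[of 2 m] by (auto simp: add.commute)
  then have "(2 * m - 2) * r\<^sup>2 + (2 * m - 3) * r = r\<^sup>2 + (m - 2) * (2 * r\<^sup>2 + 2 * r) + (r\<^sup>2 + r)"
    by (simp add: algebra_simps)
  then show ?thesis by (simp only: power_add mult_ac)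
qed

text \<open>
  Both sides are limits of \<open>U m L q\<close> for \<open>L \<rightarrow> \<infinity>\<close>: on the one hand as partial sums over boxes, on
  the other hand through the tails, which converge and are uniformly bounded, so that Tannery's theorem
  applies to the sum over \<open>r\<close>.
\<close>

lemma infsum_summand_sums:
  assumes q: "norm q < 1" "q \<noteq> 0" and m: "m \<ge> 2"
  shows "(\<lambda>r. q ^ ((2 * m - 2) * r\<^sup>2 + (2 * m - 3) * r) * (1 - q ^ (2 * r + 1)))
           sums (\<Sum>\<^sub>\<infinity>n\<in>({1..m-1} \<rightarrow>\<^sub>E UNIV). summand m q n)"
proof -
  have nz: "q ^ (2 * j) \<noteq> 1" if "0 < j" for j
    using power_neq_one_of_norm_less[OF q(1)] that by simp
  obtain K where K: "\<And>L r. norm (alt_tail q L r) \<le> K"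
    by (rule alt_tail_bounded[OF q(1)]) blast
  have K0: "0 \<le> K" using K[of 0 0] norm_ge_zero order.trans by blast
  define h where "h = (\<lambda>r. q ^ (r\<^sup>2 + (m - 2) * (2 * r\<^sup>2 + 2 * r)) * (1 - q ^ (2 * r + 1)))"
  define a where "a = (\<lambda>r L. if r < L then h r * ((-1) ^ r * alt_tail q L r) else 0)"
  have h: "norm (h r) \<le> 2 * norm q ^ r" for r
  proof -
    have "r \<le> r\<^sup>2" by (simp add: power2_eq_square)
    then have "norm q ^ (r\<^sup>2 + (m - 2) * (2 * r\<^sup>2 + 2 * r)) \<le> norm q ^ r"
      using q by (intro power_decreasing) auto
    moreover have "norm (1 - q ^ (2 * r + 1)) \<le> 1 + 1"
      using q by (intro norm_triangle_le_diff add_mono) (auto simp: norm_power intro!: power_le_one simp del: power_Suc)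
    ultimately have "norm (h r) \<le> norm q ^ r * (1 + 1)"
      unfolding h_def norm_mult norm_power by (intro mult_mono) auto
    then show ?thesis by simp
  qed
  have aU: "(\<Sum>r. a r L) = U m L q" for L
  proof -
    have "(\<Sum>r. a r L) = (\<Sum>r<L. a r L)"
      by (intro suminf_finite) (auto simp: a_def)
    then show ?thesis
      by (simp add: U_eq_alt_tail[OF nz m] a_def h_def)
  qed
  have T: "(\<forall>\<^sub>F L in sequentially. summable (\<lambda>r. norm (a r L))) \<and> summable (\<lambda>r. norm (h r * q ^ (r\<^sup>2 + r))) \<and>
    (\<lambda>L. \<Sum>r. a r L) \<longlonglongrightarrow> (\<Sum>r. h r * q ^ (r\<^sup>2 + r))"
  proof (rule tannerys_theorem)
    show "(\<lambda>L. a r L) \<longlonglongrightarrow> h r * q ^ (r\<^sup>2 + r)" for r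
    proof -
      have "\<forall>\<^sub>F L in sequentially. h r * ((-1) ^ r * alt_tail q L r) = a r L"
        using eventually_gt_at_top[of r] by eventually_elim (simp add: a_def)
      then show ?thesis
        using tendsto_mult[OF tendsto_const alt_tail_tendsto[OF q]] by (rule Lim_transform_eventually[rotated])
    qed
    have "norm (a r L) \<le> 2 * norm q ^ r * K" for r L
      using mult_mono[OF h K[of L r]] K0 q by (auto simp: a_def norm_mult norm_power)
    then show "\<forall>\<^sub>F (r, L) in sequentially \<times>\<^sub>F sequentially. norm (a r L) \<le> 2 * norm q ^ r * K"
      by (intro always_eventually) auto
    show "summable (\<lambda>r. 2 * norm q ^ r * K)"
      using q by (intro summable_mult summable_mult2 summable_geometric) auto
  qed auto
  then have "summable (\<lambda>r. h r * q ^ (r\<^sup>2 + r))"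
    by (elim conjE) (rule summable_norm_cancel)
  moreover have "(\<Sum>r. h r * q ^ (r\<^sup>2 + r)) = (\<Sum>\<^sub>\<infinity>n\<in>({1..m-1} \<rightarrow>\<^sub>E UNIV). summand m q n)"
    using T[unfolded aU] by (elim conjE) (rule LIMSEQ_unique[OF _ U_tendsto_infsum[OF q(1) m]])
  ultimately have "(\<lambda>r. h r * q ^ (r\<^sup>2 + r)) sums (\<Sum>\<^sub>\<infinity>n\<in>({1..m-1} \<rightarrow>\<^sub>E UNIV). summand m q n)"
    by (auto dest: summable_sums)
  then show ?thesis
    unfolding h_def theta_term_eq[OF m] by simp
qed

section \<open>Radial limits of partial theta series\<close>

lemma exp_minus_bounds:
  fixes s :: real
  assumes "0 \<le> s"
  shows "0 \<le> exp (- s) - 1 + s" "exp (- s) - 1 + s \<le> s\<^sup>2"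
proof -
  show "0 \<le> exp (- s) - 1 + s"
    using exp_ge_add_one_self[of "- s"] by linarith
  have "exp (- s) \<le> 1 / (1 + s)"
    using exp_ge_add_one_self[of s] assms by (simp add: exp_minus inverse_eq_divide frac_le)
  also have "1 / (1 + s) \<le> 1 - s + s\<^sup>2"
  proof -
    have "1 \<le> (1 - s + s\<^sup>2) * (1 + s)"
      using assms by (simp add: algebra_simps power2_eq_square)
    then show ?thesis using assms by (simp add: divide_le_eq)
  qed
  finally show "exp (- s) - 1 + s \<le> s\<^sup>2" by linarith
qed

lemma exp_minus_times_quadratic_le:
  fixes a w :: real
  assumes "0 < a" "0 \<le> w"
  shows "exp (- (a * w)) * (2 + 2 * w)\<^sup>2 \<le> 4 * (max 1 (2 / a))\<^sup>2"
proof -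
  define p where "p = max 1 (2 / a)"
  \<comment> \<open>The constant is chosen so that \<open>1 + w\<close> is at most \<open>p exp (a w / 2)\<close>, whose square absorbs the decaying exponential.\<close>
  have "w \<le> p * (a * w / 2)"
    using assms mult_right_mono[of "2 / a" p "a * w / 2"] by (simp add: p_def)
  moreover have "1 \<le> p" by (simp add: p_def)
  ultimately have "1 + w \<le> p * (1 + a * w / 2)" by (simp add: distrib_left)
  also have "\<dots> \<le> p * exp (a * w / 2)"
    using \<open>1 \<le> p\<close> exp_ge_add_one_self[of "a * w / 2"] by (intro mult_left_mono) auto
  finally have "(2 + 2 * w)\<^sup>2 \<le> (2 * (p * exp (a * w / 2)))\<^sup>2"
    using assms by (intro power_mono) auto
  also have "\<dots> = 4 * p\<^sup>2 * exp (a * w)"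
    by (simp add: power_mult_distrib exp_double[symmetric])
  finally have "exp (- (a * w)) * (2 + 2 * w)\<^sup>2 \<le> exp (- (a * w)) * (4 * p\<^sup>2 * exp (a * w))"
    by (intro mult_left_mono) auto
  then show ?thesis by (simp add: p_def exp_minus field_simps)
qed

text \<open>
  Each Gaussian sum grows like \<open>1 / sqrt t\<close>; the difference of two with the same leading
  coefficient converges. If \<open>b' = b + 2 a\<close>, the second sum is the first one with
  the index shifted by one, up to the constants, and the difference telescopes. In
  general, subtracting the multiple \<open>\<kappa>\<close> of the telescoping series with the same linear term leaves a series \<open>e\<close>
  that is dominated by a multiple of \<open>1 / (l + 1)\<^sup>2\<close> and tends to \<open>0\<close> termwise.
\<close>

lemma gauss_difference_limit:
  fixes a b c b' c' :: real
  assumes a: "0 < a" and nn: "0 \<le> b" "0 \<le> c" "0 \<le> b'" "0 \<le> c'"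
  defines "d \<equiv> \<lambda>l t. exp (- (t * (a * (real l)\<^sup>2 + b * real l + c))) - exp (- (t * (a * (real l)\<^sup>2 + b' * real l + c')))"
  shows "\<forall>\<^sub>F t in at_right 0. summable (\<lambda>l. d l t)"
    and "((\<lambda>t. \<Sum>l. d l t) \<longlongrightarrow> (b' - b) / (2 * a)) (at_right 0)"
proof -
  define \<kappa> where "\<kappa> = (b' - b) / (2 * a)"
  define g where "g = (\<lambda>l t. exp (- (t * (a * (real l)\<^sup>2))))"
  define e where "e = (\<lambda>l t. d l t - \<kappa> * (g l t - g (Suc l) t))"
  define D1 where "D1 = \<bar>c' - c - \<kappa> * a\<bar>"
  define D2 where "D2 = (b + c)\<^sup>2 + (b' + c')\<^sup>2 + \<bar>\<kappa>\<bar> * (2 * a)\<^sup>2"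
  define M where "M = (D1 + D2) * (4 * (max 1 (2 / a))\<^sup>2)"
  have bound: "\<bar>e l t\<bar> \<le> M * (1 / (real (Suc l))\<^sup>2)" if t: "0 < t" "t \<le> 1" for l t
  proof -
    define \<phi> where "\<phi> = (\<lambda>s :: real. exp (- s) - 1 + s)"
    define L where "L = real (Suc l)"
    have L: "1 \<le> L" "real l = L - 1" by (simp_all add: L_def)
    define x y z where "x = t * (b * real l + c)" and "y = t * (b' * real l + c')" and "z = t * a * (2 * real l + 1)"
    have pos: "0 \<le> x" "0 \<le> y" "0 \<le> z"
      using t nn a by (simp_all add: x_def y_def z_def)
    have gS: "g (Suc l) t = g l t * exp (- z)"
      unfolding g_def z_def exp_add[symmetric] by (simp add: power2_eq_square algebra_simps)
    have dl: "d l t = g l t * (exp (- x) - exp (- y))"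
      unfolding g_def d_def x_def y_def right_diff_distrib exp_add[symmetric] by (simp add: algebra_simps)
    \<comment> \<open>The choice of \<open>\<kappa>\<close> removes the terms of order \<open>t l\<close>.\<close>
    have lin: "y - x - \<kappa> * z = t * (c' - c - \<kappa> * a)"
    proof -
      have "2 * a * \<kappa> = b' - b" using a by (simp add: \<kappa>_def)
      then have "\<kappa> * z = t * ((b' - b) * real l + \<kappa> * a)"
        unfolding z_def by (simp add: algebra_simps flip: \<open>2 * a * \<kappa> = b' - b\<close>)
      then show ?thesis unfolding x_def y_def by (simp add: algebra_simps)
    qed
    have "e l t = g l t * (\<phi> x - \<phi> y + \<kappa> * \<phi> z + (y - x - \<kappa> * z))"
      unfolding e_def gS dl \<phi>_def by (simp add: algebra_simps)
    then have el: "\<bar>e l t\<bar> = g l t * \<bar>\<phi> x - \<phi> y + \<kappa> * \<phi> z + t * (c' - c - \<kappa> * a)\<bar>"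
      unfolding lin by (simp add: abs_mult g_def)
    have \<phi>: "0 \<le> \<phi> s" "\<phi> s \<le> s\<^sup>2" if "0 \<le> s" for s
      using exp_minus_bounds[OF that] by (simp_all add: \<phi>_def)
    have "x \<le> t * ((b + c) * L)" "y \<le> t * ((b' + c') * L)" "z \<le> t * (2 * a * L)"
      unfolding x_def y_def z_def using t nn a L by (auto simp: mult.assoc algebra_simps intro!: mult_left_mono)
    then have sq: "x\<^sup>2 \<le> (t * ((b + c) * L))\<^sup>2" "y\<^sup>2 \<le> (t * ((b' + c') * L))\<^sup>2" "z\<^sup>2 \<le> (t * (2 * a * L))\<^sup>2"
      using pos by (auto intro: power_mono)
    have "\<bar>\<phi> x - \<phi> y + \<kappa> * \<phi> z + t * (c' - c - \<kappa> * a)\<bar> \<le> \<bar>\<phi> x\<bar> + \<bar>\<phi> y\<bar> + \<bar>\<kappa> * \<phi> z\<bar> + \<bar>t * (c' - c - \<kappa> * a)\<bar>"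
      by linarith
    also have "\<dots> \<le> (t * ((b + c) * L))\<^sup>2 + (t * ((b' + c') * L))\<^sup>2 + \<bar>\<kappa>\<bar> * (t * (2 * a * L))\<^sup>2 + t * D1"
      using \<phi>[OF pos(1)] \<phi>[OF pos(2)] \<phi>[OF pos(3)] sq t
      by (intro add_mono) (auto simp: abs_mult D1_def intro!: mult_left_mono)
    also have "\<dots> = D2 * (t\<^sup>2 * L\<^sup>2) + D1 * t"
      unfolding D2_def power_mult_distrib by (simp add: algebra_simps)
    finally have "\<bar>e l t\<bar> \<le> g l t * (D2 * (t\<^sup>2 * L\<^sup>2) + D1 * t)"
      unfolding el by (intro mult_left_mono) (auto simp: g_def)
    then have "\<bar>e l t\<bar> * L\<^sup>2 \<le> g l t * (D2 * (t\<^sup>2 * L\<^sup>2) + D1 * t) * L\<^sup>2"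
      by (intro mult_right_mono) auto
    also have "\<dots> = g l t * (D2 * (t * L\<^sup>2)\<^sup>2 + D1 * (t * L\<^sup>2))"
      by (simp add: power_mult_distrib algebra_simps power2_eq_square)
    also have "\<dots> \<le> g l t * (D2 * (2 + 2 * (t * (real l)\<^sup>2))\<^sup>2 + D1 * (2 + 2 * (t * (real l)\<^sup>2))\<^sup>2)"
    proof -
      let ?w = "t * (real l)\<^sup>2"
      have "0 \<le> (real l - 1)\<^sup>2" by simp
      then have "L\<^sup>2 \<le> 2 + 2 * (real l)\<^sup>2"
        unfolding L_def by (simp add: power2_eq_square algebra_simps)
      then have "t * L\<^sup>2 \<le> t * 2 + 2 * ?w" using t by (metis (no_types) distrib_left mult.left_commute mult_left_mono less_imp_le)
      then have 1: "t * L\<^sup>2 \<le> 2 + 2 * ?w" using t by linarith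
      have "0 \<le> ?w" using t by simp
      then have 2: "2 + 2 * ?w \<le> (2 + 2 * ?w)\<^sup>2" by (intro self_le_power) auto
      have "0 \<le> t * L\<^sup>2" using t by simp
      with 1 have "(t * L\<^sup>2)\<^sup>2 \<le> (2 + 2 * ?w)\<^sup>2" by (intro power_mono)
      with 1 2 show ?thesis
        using a by (intro mult_left_mono add_mono) (auto simp: D1_def D2_def g_def)
    qed
    also have "\<dots> = (D1 + D2) * (exp (- (a * (t * (real l)\<^sup>2))) * (2 + 2 * (t * (real l)\<^sup>2))\<^sup>2)"
      unfolding g_def by (simp add: algebra_simps)
    also have "\<dots> \<le> M"
      unfolding M_def using a t
      by (intro mult_left_mono exp_minus_times_quadratic_le) (auto simp: D1_def D2_def)
    finally show ?thesis
      using L unfolding L_def[symmetric] by (simp only: mult_1_right times_divide_eq_right) (simp add: pos_le_divide_eq)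
  qed
  have ev: "\<forall>\<^sub>F t in at_right (0 :: real). 0 < t \<and> t \<le> 1"
    using eventually_at_right_field[of "\<lambda>t. 0 < t \<and> t \<le> 1" 0] by (auto intro!: exI[of _ 1])
  have T: "(\<forall>\<^sub>F t in at_right 0. summable (\<lambda>l. norm (e l t))) \<and> summable (\<lambda>l. norm (0 :: real)) \<and>
     ((\<lambda>t. \<Sum>l. e l t) \<longlongrightarrow> (\<Sum>l. 0)) (at_right 0)"
  proof (rule tannerys_theorem)
    show "((\<lambda>t. e l t) \<longlongrightarrow> 0) (at_right 0)" for l
      unfolding e_def d_def g_def by (auto intro!: tendsto_eq_intros)
    have "\<forall>\<^sub>F (l, t) in sequentially \<times>\<^sub>F at_right 0. True \<and> (0 < t \<and> t \<le> (1::real))"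
      using eventually_prodI[OF always_eventually[of "\<lambda>_. True"] ev] by (simp add: case_prod_unfold)
    then show "\<forall>\<^sub>F (l, t) in sequentially \<times>\<^sub>F at_right 0. norm (e l t) \<le> M * (1 / (real (Suc l))\<^sup>2)"
      by eventually_elim (use bound in auto)
    have "summable (\<lambda>l. 1 / (real (Suc l))\<^sup>2)"
      using summable_Suc_iff[of "\<lambda>l. inverse ((real l)\<^sup>2)"] inverse_power_summable[of 2, where 'a = real]
      by (simp add: inverse_eq_divide)
    then show "summable (\<lambda>l. M * (1 / (real (Suc l))\<^sup>2))" by (rule summable_mult)
  qed (simp add: trivial_limit_at_right_real)
  have tel: "(\<lambda>l. g l t - g (Suc l) t) sums 1" if "0 < t" for t
  proof -
    have "(\<lambda>l. g l t) \<longlonglongrightarrow> 0"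
    proof (rule Lim_null_comparison)
      show "(\<lambda>l. exp (- (t * a)) ^ l) \<longlonglongrightarrow> 0"
        using that a by (intro LIMSEQ_power_zero) simp
      show "\<forall>\<^sub>F l in sequentially. norm (g l t) \<le> exp (- (t * a)) ^ l"
      proof (intro always_eventually allI)
        fix l
        have "real l \<le> (real l)\<^sup>2" by (cases l) (auto simp: power2_eq_square)
        then have "t * a * real l \<le> t * a * (real l)\<^sup>2"
          using that a by (intro mult_left_mono) auto
        then show "norm (g l t) \<le> exp (- (t * a)) ^ l"
          by (simp add: g_def exp_of_nat_mult[symmetric] mult_ac)
      qed
    qed
    moreover have "g 0 t - 0 = 1" by (simp add: g_def)
    ultimately show ?thesis using telescope_sums'[of "\<lambda>l. g l t" 0] by (simp only: not_False_eq_True)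
  qed
  have main: "\<forall>\<^sub>F t in at_right 0. summable (\<lambda>l. d l t) \<and> (\<Sum>l. d l t) = (\<Sum>l. e l t) + \<kappa>"
    using conjunct1[OF T] ev
  proof eventually_elim
    case (elim t)
    have "(\<lambda>l. e l t) sums (\<Sum>l. e l t)"
      using elim(1) by (intro summable_sums) (rule summable_norm_cancel)
    from sums_add[OF this sums_mult[OF tel, of t \<kappa>]] elim(2)
    have "(\<lambda>l. d l t) sums ((\<Sum>l. e l t) + \<kappa>)"
      by (simp add: e_def)
    then show ?case by (simp only: sums_iff simp_thms)
  qed
  then show "\<forall>\<^sub>F t in at_right 0. summable (\<lambda>l. d l t)"
    by eventually_elim simp
  have "((\<lambda>t. (\<Sum>l. e l t) + \<kappa>) \<longlongrightarrow> 0 + \<kappa>) (at_right 0)"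
    using T by (intro tendsto_intros) simp
  moreover have "\<forall>\<^sub>F t in at_right 0. (\<Sum>l. e l t) + \<kappa> = (\<Sum>l. d l t)"
    using main by eventually_elim simp
  ultimately show "((\<lambda>t. \<Sum>l. d l t) \<longlongrightarrow> (b' - b) / (2 * a)) (at_right 0)"
    unfolding \<kappa>_def by (simp add: Lim_transform_eventually)
qed

lemma root_power_add_mult:
  fixes \<zeta> :: complex
  assumes "\<zeta> ^ N = 1"
  shows "\<zeta> ^ (a + N * b) = \<zeta> ^ a"
  using assms by (simp add: power_add power_mult)

text \<open>
  The two quadratic exponents are \<open>P(- 1 - u)\<close> and \<open>P(s)\<close> for \<open>P(x) = A x\<^sup>2 + (A - 1) x\<close>, and
  \<open>- 1 - u\<close> is congruent to \<open>s\<close> modulo \<open>N\<close>.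
\<close>

lemma reflected_exponent:
  fixes \<zeta> :: complex
  assumes z: "\<zeta> ^ N = 1" and A: "1 \<le> A" and u: "u + s + 1 = N"
  shows "\<zeta> ^ (A * u\<^sup>2 + (A + 1) * u + 1) = \<zeta> ^ (A * s\<^sup>2 + (A - 1) * s)"
proof -
  obtain B where A: "A = B + 1" using A by (metis add.commute le_Suc_ex)
  have "(A * u\<^sup>2 + (A + 1) * u + 1) + N * (A * s) = (A * s\<^sup>2 + (A - 1) * s) + N * (A * u + 1)"
    unfolding A u[symmetric] by (simp add: power2_eq_square algebra_simps)
  then show ?thesis
    by (metis root_power_add_mult[OF z])
qed

text \<open>
  One period of the theta series. Reversing the order of the subtracted terms pairs exponentials with the
  same power of \<open>\<zeta>\<close>, which makes the cancellation over a period visible.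
\<close>

lemma partial_theta_block:
  fixes \<zeta> :: complex and t :: real
  assumes z: "\<zeta> ^ N = 1" and A: "1 \<le> A"
  defines "q \<equiv> \<zeta> * of_real (exp (- t))"
  shows "(\<Sum>r\<in>{l * N..<l * N + N}. q ^ (A * r\<^sup>2 + (A - 1) * r) * (1 - q ^ (2 * r + 1)))
    = (\<Sum>s<N. \<zeta> ^ (A * s\<^sup>2 + (A - 1) * s) *
        of_real (exp (- (t * real (A * (l * N + s)\<^sup>2 + (A - 1) * (l * N + s))))
               - exp (- (t * real (A * (l * N + (N - 1 - s))\<^sup>2 + (A + 1) * (l * N + (N - 1 - s)) + 1)))))"
proof -
  have q: "q ^ n = \<zeta> ^ n * of_real (exp (- (t * real n)))" for n
    unfolding q_def by (simp add: power_mult_distrib exp_of_nat_mult[symmetric] mult.commute flip: of_real_power)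
  let ?P = "\<lambda>r. A * r\<^sup>2 + (A - 1) * r" and ?P' = "\<lambda>r. A * r\<^sup>2 + (A + 1) * r + 1"
  have "(\<Sum>r\<in>{l * N..<l * N + N}. q ^ ?P r * (1 - q ^ (2 * r + 1)))
      = (\<Sum>s<N. q ^ ?P (l * N + s) * (1 - q ^ (2 * (l * N + s) + 1)))"
    by (rule sum.reindex_bij_witness[of _ "\<lambda>s. l * N + s" "\<lambda>r. r - l * N"]) auto
  also have "\<dots> = (\<Sum>s<N. q ^ ?P (l * N + s)) - (\<Sum>s<N. q ^ ?P' (l * N + s))"
    unfolding sum_subtractf[symmetric]
  proof (intro sum.cong refl)
    fix s
    have "?P' r = ?P r + (2 * r + 1)" for r
      using A by (cases A) (simp_all add: algebra_simps)
    then have "q ^ ?P' (l * N + s) = q ^ ?P (l * N + s) * q ^ (2 * (l * N + s) + 1)"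
      by (simp only: power_add)
    then show "q ^ ?P (l * N + s) * (1 - q ^ (2 * (l * N + s) + 1)) = q ^ ?P (l * N + s) - q ^ ?P' (l * N + s)"
      by (simp only: right_diff_distrib mult_1_right)
  qed
  also have "(\<Sum>s<N. q ^ ?P' (l * N + s)) = (\<Sum>s<N. q ^ ?P' (l * N + (N - 1 - s)))"
    using sum.nat_diff_reindex[of "\<lambda>s. q ^ ?P' (l * N + s)" N] by simp
  also have "(\<Sum>s<N. q ^ ?P (l * N + s)) - \<dots>
     = (\<Sum>s<N. \<zeta> ^ ?P s * of_real (exp (- (t * real (?P (l * N + s)))) - exp (- (t * real (?P' (l * N + (N - 1 - s)))))))"
    unfolding sum_subtractf[symmetric]
  proof (intro sum.cong refl)
    fix s assume s: "s \<in> {..<N}"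
    have "?P (l * N + s) = ?P s + N * (A * (l * l * N + 2 * l * s) + (A - 1) * l)"
      by (simp add: power2_eq_square algebra_simps)
    then have 1: "\<zeta> ^ ?P (l * N + s) = \<zeta> ^ ?P s"
      by (simp only: root_power_add_mult[OF z])
    have "?P' (l * N + u) = ?P' u + N * (A * (l * l * N + 2 * l * u) + (A + 1) * l)" for u
      by (simp add: power2_eq_square algebra_simps)
    then have "\<zeta> ^ ?P' (l * N + (N - 1 - s)) = \<zeta> ^ ?P' (N - 1 - s)"
      by (simp only: root_power_add_mult[OF z])
    also have "\<dots> = \<zeta> ^ ?P s"
      using s by (intro reflected_exponent[OF z A]) auto
    finally show "q ^ ?P (l * N + s) - q ^ ?P' (l * N + (N - 1 - s))
      = \<zeta> ^ ?P s * of_real (exp (- (t * real (?P (l * N + s)))) - exp (- (t * real (?P' (l * N + (N - 1 - s))))))"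
      unfolding q 1 of_real_diff right_diff_distrib by simp
  qed
  finally show ?thesis .
qed

lemma partial_theta_radial_limit:
  fixes \<zeta> :: complex and S :: "real \<Rightarrow> complex"
  assumes z: "\<zeta> ^ N = 1" and N: "1 \<le> N" and A: "1 \<le> A"
    and S: "\<And>t. 0 < t \<Longrightarrow> (\<lambda>r. (\<zeta> * of_real (exp (- t))) ^ (A * r\<^sup>2 + (A - 1) * r) * (1 - (\<zeta> * of_real (exp (- t))) ^ (2 * r + 1))) sums S t"
  shows "(S \<longlongrightarrow> (\<Sum>s<N. \<zeta> ^ (A * s\<^sup>2 + (A - 1) * s) *
           of_real ((real A * (real (N - 1 - s) - real s) + 1) / (real A * real N)))) (at_right 0)"
proof -
  define d where "d = (\<lambda>s l t. exp (- (t * real (A * (l * N + s)\<^sup>2 + (A - 1) * (l * N + s))))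
               - exp (- (t * real (A * (l * N + (N - 1 - s))\<^sup>2 + (A + 1) * (l * N + (N - 1 - s)) + 1))))"
  have d: "(\<forall>\<^sub>F t in at_right 0. summable (\<lambda>l. d s l t)) \<and>
     ((\<lambda>t. \<Sum>l. d s l t) \<longlongrightarrow> (real A * (real (N - 1 - s) - real s) + 1) / (real A * real N)) (at_right 0)" for s
  proof -
    define a b c b' c' where "a = real A * (real N)\<^sup>2" and "b = 2 * real A * real s * real N + real (A - 1) * real N"
      and "c = real (A * s\<^sup>2 + (A - 1) * s)"
      and "b' = 2 * real A * real (N - 1 - s) * real N + real (A + 1) * real N"
      and "c' = real (A * (N - 1 - s)\<^sup>2 + (A + 1) * (N - 1 - s) + 1)"
    have "0 < a" using A N by (simp add: a_def)
    moreover have "0 \<le> b" "0 \<le> c" "0 \<le> b'" "0 \<le> c'"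
      by (simp_all add: b_def c_def b'_def c'_def)
    moreover have "d s l t = exp (- (t * (a * (real l)\<^sup>2 + b * real l + c))) - exp (- (t * (a * (real l)\<^sup>2 + b' * real l + c')))" for l t
    proof -
      have "real (A * (l * N + s)\<^sup>2 + (A - 1) * (l * N + s)) = a * (real l)\<^sup>2 + b * real l + c"
        unfolding a_def b_def c_def using A by (cases A) (simp_all add: power2_eq_square algebra_simps)
      moreover have "real (A * (l * N + u)\<^sup>2 + (A + 1) * (l * N + u) + 1)
         = real A * (real N)\<^sup>2 * (real l)\<^sup>2 + (2 * real A * real u * real N + real (A + 1) * real N) * real l
           + real (A * u\<^sup>2 + (A + 1) * u + 1)" for u
        by (simp add: power2_eq_square algebra_simps)
      ultimately show ?thesis
        unfolding d_def a_def b'_def c'_def by (simp only:)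
    qed
    moreover have "(b' - b) / (2 * a) = (real A * (real (N - 1 - s) - real s) + 1) / (real A * real N)"
    proof -
      have "b' - b = (2 * real N) * (real A * (real (N - 1 - s) - real s) + 1)"
        using A unfolding b_def b'_def by (simp add: of_nat_diff algebra_simps)
      moreover have "2 * a = (2 * real N) * (real A * real N)" by (simp add: a_def power2_eq_square)
      ultimately show ?thesis using N by (simp only: mult_divide_mult_cancel_left_if) simp
    qed
    ultimately show ?thesis
      using gauss_difference_limit[of a b c b' c'] by simp
  qed
  have "((\<lambda>t. \<Sum>s<N. \<zeta> ^ (A * s\<^sup>2 + (A - 1) * s) * of_real (\<Sum>l. d s l t)) \<longlongrightarrow>
      (\<Sum>s<N. \<zeta> ^ (A * s\<^sup>2 + (A - 1) * s) * of_real ((real A * (real (N - 1 - s) - real s) + 1) / (real A * real N)))) (at_right 0)"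
    using d by (intro tendsto_intros) blast
  moreover have "\<forall>\<^sub>F t in at_right 0. \<forall>s\<in>{..<N}. summable (\<lambda>l. d s l t)"
    using d by (intro eventually_ball_finite) auto
  then have "\<forall>\<^sub>F t in at_right 0. (\<Sum>s<N. \<zeta> ^ (A * s\<^sup>2 + (A - 1) * s) * of_real (\<Sum>l. d s l t)) = S t"
    using eventually_at_right_less[of "0 :: real"]
  proof eventually_elim
    case (elim t)
    from sums_group[OF S[OF elim(2)], of N] N
    have "(\<lambda>l. \<Sum>s<N. \<zeta> ^ (A * s\<^sup>2 + (A - 1) * s) * of_real (d s l t)) sums S t"
      unfolding partial_theta_block[OF z A] d_def by simp
    moreover have "(\<lambda>l. \<Sum>s<N. \<zeta> ^ (A * s\<^sup>2 + (A - 1) * s) * of_real (d s l t)) sums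
       (\<Sum>s<N. \<zeta> ^ (A * s\<^sup>2 + (A - 1) * s) * of_real (\<Sum>l. d s l t))"
      using elim(1) by (intro sums_sum sums_mult sums_of_real summable_sums) auto
    ultimately show ?case by (rule sums_unique2[symmetric])
  qed
  ultimately show ?thesis by (rule Lim_transform_eventually)
qed

section \<open>The truncated sum at a root of unity\<close>

lemma root_power_eq_1_iff:
  fixes \<zeta> :: complex
  assumes z: "\<zeta> ^ N = 1" and prim: "\<And>k. 0 < k \<Longrightarrow> k < N \<Longrightarrow> \<zeta> ^ k \<noteq> 1" and N: "1 \<le> N"
  shows "\<zeta> ^ k = 1 \<longleftrightarrow> N dvd k"
proof -
  have "\<zeta> ^ k = \<zeta> ^ (k mod N + N * (k div N))" by simp
  also have "\<dots> = \<zeta> ^ (k mod N)" by (rule root_power_add_mult[OF z])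
  finally have "\<zeta> ^ k = 1 \<longleftrightarrow> \<zeta> ^ (k mod N) = 1" by simp
  also have "\<dots> \<longleftrightarrow> k mod N = 0"
    using prim[of "k mod N"] N by (cases "k mod N = 0") auto
  finally show ?thesis by (simp add: mod_eq_0_iff_dvd)
qed

text \<open>
  The polynomials \<open>\<Prod>\<^sub>j (x - \<omega>^j)\<close> and \<open>1 + x + \<dots> + x^(N - 1)\<close> are monic with the same roots; evaluate
  them at \<open>1\<close>.
\<close>

lemma qfact_primitive_root:
  fixes \<omega> :: complex
  assumes z: "\<omega> ^ N = 1" and prim: "\<And>k. 0 < k \<Longrightarrow> k < N \<Longrightarrow> \<omega> ^ k \<noteq> 1" and N: "1 \<le> N"
  shows "qfact \<omega> (N - 1) = of_nat N"
proof -
  define p where "p = (\<Prod>j<N - 1. [:- (\<omega> ^ Suc j), 1:])"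
  define s where "s = (\<Sum>i<N. monom (1::complex) i)"
  have w0: "\<omega> \<noteq> 0" using z N by (auto simp: power_0_left)
  have inj: "inj_on (\<lambda>j. \<omega> ^ Suc j) {..<N - 1}"
  proof (rule linorder_inj_onI)
    fix i j assume ij: "i < j" "i \<in> {..<N - 1}" "j \<in> {..<N - 1}"
    have "\<omega> ^ Suc j = \<omega> ^ Suc i * \<omega> ^ (j - i)"
      using ij by (simp flip: power_add)
    moreover have "\<omega> ^ (j - i) \<noteq> 1" using ij by (intro prim) auto
    ultimately show "\<omega> ^ Suc i \<noteq> \<omega> ^ Suc j" using w0 by auto
  qed auto
  have "p = s"
  proof (rule poly_eqI_degree_lead_coeff[where n = "N - 1" and A = "(\<lambda>j. \<omega> ^ Suc j) ` {..<N - 1}"])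
    have deg: "degree p = N - 1"
      unfolding p_def by (subst degree_prod_eq_sum_degree) (auto simp del: power_Suc)
    then show "degree p \<le> N - 1" by simp
    have "coeff p (N - 1) = lead_coeff p" by (simp add: deg)
    also have "\<dots> = 1" unfolding p_def lead_coeff_prod by simp
    also have "1 = coeff s (N - 1)"
      using N by (simp add: s_def coeff_sum coeff_monom)
    finally show "coeff p (N - 1) = coeff s (N - 1)" .
    show "N - 1 \<le> card ((\<lambda>j. \<omega> ^ Suc j) ` {..<N - 1})"
      unfolding card_image[OF inj] by simp
    show "degree s \<le> N - 1"
      unfolding s_def by (intro degree_sum_le) (auto simp: degree_monom_eq)
    fix x assume "x \<in> (\<lambda>j. \<omega> ^ Suc j) ` {..<N - 1}"
    then obtain j where j: "j < N - 1" "x = \<omega> ^ Suc j" by auto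
    have "poly p x = 0"
      unfolding p_def poly_prod using j by (intro prod_zero) auto
    moreover have "poly s x = 0"
    proof -
      have "x \<noteq> 1" unfolding j(2) using j(1) by (intro prim) auto
      moreover have "x ^ N = 1" unfolding j(2) by (metis power_mult mult.commute z power_one)
      ultimately show ?thesis
        by (simp add: s_def poly_sum poly_monom sum_gp_strict)
    qed
    ultimately show "poly p x = poly s x" by simp
  qed
  then have "poly p 1 = poly s 1" by simp
  then show ?thesis
    by (simp add: p_def s_def poly_prod poly_sum poly_monom qpoch_def)
qed

text \<open>
  The increments of the regular part of the tails are antisymmetric under \<open>j \<mapsto> N - j\<close>. For odd
  \<open>N\<close> the sign comes from \<open>(-1)^N\<close>; the quotient \<open>(1 + \<zeta>^(2 j)) / \<zeta>^(j\<^sup>2 + j)\<close> and the denominators are symmetric.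
\<close>

lemma reflected_weight:
  fixes \<zeta> :: complex
  assumes z: "\<zeta> ^ N = 1" and "odd N" and ij: "i + j = N"
  shows "(-1) ^ i * (1 + \<zeta> ^ (2 * i)) / \<zeta> ^ (i\<^sup>2 + i) / (qfact (\<zeta>\<^sup>2) (N - i) * qfact (\<zeta>\<^sup>2) i)
       = - ((-1) ^ j * (1 + \<zeta> ^ (2 * j)) / \<zeta> ^ (j\<^sup>2 + j) / (qfact (\<zeta>\<^sup>2) (N - j) * qfact (\<zeta>\<^sup>2) j))"
proof -
  have z0: "\<zeta> \<noteq> 0" using z \<open>odd N\<close> by (auto simp: power_0_left odd_pos split: if_splits)
  have e: "\<zeta> ^ (b\<^sup>2 + b) = \<zeta> ^ (2 * b) * \<zeta> ^ (a\<^sup>2 + a)" if "a + b = N" for a b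
  proof -
    have "(b\<^sup>2 + b) + N * (a + 1) = 2 * b + (a\<^sup>2 + a) + N * b"
      unfolding that[symmetric] by (simp add: power2_eq_square algebra_simps)
    then show ?thesis
      unfolding power_add[symmetric] by (metis root_power_add_mult[OF z])
  qed
  have s: "(-1 :: complex) ^ i = - ((-1) ^ j)"
    using ij \<open>odd N\<close> by (cases "even i") auto
  have "(1 + \<zeta> ^ (2 * i)) * \<zeta> ^ (j\<^sup>2 + j) = (1 + \<zeta> ^ (2 * j)) * \<zeta> ^ (i\<^sup>2 + i)"
  proof -
    have "\<zeta> ^ (j\<^sup>2 + j) = \<zeta> ^ (2 * j) * \<zeta> ^ (i\<^sup>2 + i)" "\<zeta> ^ (2 * i) * \<zeta> ^ (j\<^sup>2 + j) = \<zeta> ^ (i\<^sup>2 + i)"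
      using e[of i j] e[of j i] ij by (simp_all only: add.commute)
    then show ?thesis by (simp only: distrib_right mult_1_left) (simp only: add.commute)
  qed
  then have "(1 + \<zeta> ^ (2 * i)) / \<zeta> ^ (i\<^sup>2 + i) = (1 + \<zeta> ^ (2 * j)) / \<zeta> ^ (j\<^sup>2 + j)"
    using z0 by (simp add: divide_eq_eq eq_divide_eq)
  moreover have "N - i = j" "N - j = i" using ij by auto
  ultimately show ?thesis
    unfolding s by (simp add: mult.commute[of "qfact _ i"] flip: times_divide_eq_right)
qed

text \<open>
  Antisymmetry of \<open>W\<close> makes its partial sums symmetric under \<open>r \<mapsto> N - 1 - r\<close>, and pairing symmetric
  with antisymmetric gives zero.
\<close>

lemma sum_reflection_zero:
  fixes f W :: "nat \<Rightarrow> complex"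
  assumes f: "\<And>r. r < N \<Longrightarrow> f (N - 1 - r) = - f r"
    and W: "\<And>j. 1 \<le> j \<Longrightarrow> j < N \<Longrightarrow> W (N - j) = - W j"
  shows "(\<Sum>r<N. f r * (\<Sum>j=1..r. W j)) = 0"
proof -
  define E where "E = (\<lambda>r. \<Sum>j=1..r. W j)"
  have refl: "E (N - 1) - E r = - E (N - 1 - r)" if "r < N" for r
  proof -
    have "{1..N - 1} = {1..r} \<union> {Suc r..N - 1}" using that by auto
    then have "E (N - 1) - E r = (\<Sum>j=Suc r..N - 1. W j)"
      unfolding E_def by (subst \<open>{1..N - 1} = _\<close>, subst sum.union_disjoint) auto
    also have "\<dots> = (\<Sum>i=1..N - 1 - r. W (N - i))"
      by (rule sum.reindex_bij_witness[of _ "\<lambda>i. N - i" "\<lambda>j. N - j"]) (use that in auto)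
    also have "\<dots> = - E (N - 1 - r)"
      unfolding E_def sum_negf[symmetric] by (intro sum.cong refl W) auto
    finally show ?thesis .
  qed
  have E: "E (N - 1 - r) = E r" if "r < N" for r
    using refl[OF that] refl[of 0] that by (simp add: E_def)
  have "(\<Sum>r<N. f (N - 1 - r) * E (N - 1 - r)) = - (\<Sum>r<N. f r * E r)"
    unfolding sum_negf[symmetric]
  proof (rule sum.cong)
    fix r assume "r \<in> {..<N}"
    then show "f (N - 1 - r) * E (N - 1 - r) = - (f r * E r)"
      using f[of r] E[of r] by simp
  qed simp
  moreover have "(\<Sum>r<N. f (N - 1 - r) * E (N - 1 - r)) = (\<Sum>r<N. f r * E r)"
    using sum.nat_diff_reindex[of "\<lambda>r. f r * E r" N] by simp
  ultimately show ?thesis by (simp add: E_def)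
qed

lemma tendsto_qpoch:
  fixes f g :: "'b \<Rightarrow> 'a::{comm_ring_1, real_normed_field}"
  assumes "(f \<longlongrightarrow> x) F" "(g \<longlongrightarrow> y) F"
  shows "((\<lambda>t. qpoch (f t) (g t) n) \<longlongrightarrow> qpoch x y n) F"
  unfolding qpoch_def by (intro tendsto_intros assms)

lemma exp_difference_quotient_limit:
  fixes \<alpha> \<beta> \<gamma> :: real
  assumes "\<gamma> \<noteq> 0"
  shows "((\<lambda>t. (exp (- (t * \<alpha>)) - exp (- (t * \<beta>))) / (1 - exp (- (t * \<gamma>)))) \<longlongrightarrow> (\<beta> - \<alpha>) / \<gamma>) (at_right 0)"
proof -
  have D: "((\<lambda>t. (exp (- (t * c)) - 1) / t) \<longlongrightarrow> - c) (at_right 0)" for c :: real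
  proof (rule tendsto_within_subset)
    have "((\<lambda>t. exp (- (t * c))) has_real_derivative - c) (at 0)"
      by (auto intro!: derivative_eq_intros)
    then show "((\<lambda>t. (exp (- (t * c)) - 1) / t) \<longlongrightarrow> - c) (at 0)"
      by (simp add: DERIV_def)
  qed simp
  have "((\<lambda>t. ((exp (- (t * \<alpha>)) - 1) / t - (exp (- (t * \<beta>)) - 1) / t) / (- ((exp (- (t * \<gamma>)) - 1) / t)))
     \<longlongrightarrow> (- \<alpha> - - \<beta>) / (- (- \<gamma>))) (at_right 0)"
    using assms by (intro tendsto_intros D) auto
  moreover have "\<forall>\<^sub>F t in at_right 0. ((exp (- (t * \<alpha>)) - 1) / t - (exp (- (t * \<beta>)) - 1) / t) / (- ((exp (- (t * \<gamma>)) - 1) / t))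
     = (exp (- (t * \<alpha>)) - exp (- (t * \<beta>))) / (1 - exp (- (t * \<gamma>)))"
    using eventually_at_right_less[of "0 :: real"]
  proof eventually_elim
    case (elim t)
    have c: "(x / t - y / t) / (- (w / t)) = (x - y) / (- w)" for x y w
      using elim by (simp add: diff_divide_distrib[symmetric])
    then show ?case unfolding c by simp
  qed
  ultimately show ?thesis
    using Lim_transform_eventually by fastforce
qed


context
  fixes \<zeta> :: complex and N :: nat
  assumes z: "\<zeta> ^ N = 1" and prim: "\<And>k. 0 < k \<Longrightarrow> k < N \<Longrightarrow> \<zeta> ^ k \<noteq> 1"
    and N: "1 \<le> N" and oddN: "odd N"
begin

lemma odd_order_dvd_double: "N dvd 2 * k \<Longrightarrow> N dvd k"
  using oddN by (simp add: coprime_dvd_mult_right_iff)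

lemma root_square_power_neq_1:
  assumes "0 < k" "k < N"
  shows "(\<zeta>\<^sup>2) ^ k \<noteq> 1"
proof
  assume "(\<zeta>\<^sup>2) ^ k = 1"
  then have "N dvd 2 * k"
    using root_power_eq_1_iff[OF z prim N, of "2 * k"] by (simp add: power_mult)
  then have "N dvd k" by (rule odd_order_dvd_double)
  then show False using assms by (simp add: nat_dvd_not_less)
qed

lemma qfact_root_nonzero: "n < N \<Longrightarrow> qfact (\<zeta>\<^sup>2) n \<noteq> 0"
  by (intro qfact_nonzero root_square_power_neq_1) auto

lemma qpoch_minus_root_nonzero: "qpoch (- \<zeta>) \<zeta> n \<noteq> 0"
proof -
  have "1 - (- \<zeta>) * \<zeta> ^ j \<noteq> 0" for j
  proof
    assume "1 - (- \<zeta>) * \<zeta> ^ j = 0"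
    then have m1: "\<zeta> ^ Suc j = - 1" by (simp add: add_eq_0_iff)
    then have "\<zeta> ^ (2 * Suc j) = 1" by (simp only: mult.commute[of 2] power_mult) simp
    then have "N dvd 2 * Suc j"
      using root_power_eq_1_iff[OF z prim N] by blast
    then have "N dvd Suc j" by (rule odd_order_dvd_double)
    then have "\<zeta> ^ Suc j = 1" using root_power_eq_1_iff[OF z prim N] by blast
    then show False using m1 by simp
  qed
  then show ?thesis by (simp add: qpoch_def)
qed

lemma U_tendsto_at_root:
  assumes q: "(q \<longlongrightarrow> \<zeta>) F"
  shows "((\<lambda>t. U m L (q t)) \<longlongrightarrow> U m L \<zeta>) F"
  unfolding U_def summand_def
  by (intro tendsto_intros tendsto_qpoch q qpoch_minus_root_nonzero isCont_tendsto_compose[OF poly_isCont])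

text \<open>
  The closed form of the tails for \<open>L = N\<close>, sorted by the behaviour of its parts as \<open>q\<close> tends to
  \<open>\<zeta>\<close>: every denominator on the right except \<open>1 - q^(2 N)\<close> has a nonzero limit.
\<close>

lemma U_split_at_pole:
  fixes q :: complex
  assumes nz: "\<And>k. 0 < k \<Longrightarrow> q ^ (2 * k) \<noteq> 1" and q0: "q \<noteq> 0" and m: "m \<ge> 2"
  defines "f \<equiv> \<lambda>r. q ^ ((2 * m - 2) * r\<^sup>2 + (2 * m - 3) * r) * (1 - q ^ (2 * r + 1))"
  shows "U m N q = (\<Sum>r<N. f r) + q ^ (N\<^sup>2 + N) / qfact (q\<^sup>2) (N - 1) * ((\<Sum>r<N. f r) / (1 - q ^ (2 * N)))
     + q ^ (N\<^sup>2 + N) * (\<Sum>r<N. f r * (\<Sum>j=1..r. (-1) ^ j * (1 + q ^ (2 * j)) / q ^ (j\<^sup>2 + j)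
          / (qfact (q\<^sup>2) (N - j) * qpoch (q\<^sup>2 * (q\<^sup>2) ^ N) (q\<^sup>2) j)))"
proof -
  let ?P = "qfact (q\<^sup>2)"
  have P: "?P k \<noteq> 0" for k
    using nz by (intro qfact_nonzero) (auto simp flip: power_mult)
  have PN: "?P N = ?P (N - 1) * (1 - q ^ (2 * N))"
    using qfact_Suc[of "q\<^sup>2" "N - 1"] N by (simp add: power_mult)
  have Padd: "?P (N + j) = ?P N * qpoch (q\<^sup>2 * (q\<^sup>2) ^ N) (q\<^sup>2) j" for j
    by (induction j) (simp_all add: qpoch_Suc power_add mult_ac)
  define w where "w = (\<lambda>j. (-1) ^ j * (1 + q ^ (2 * j)) / q ^ (j\<^sup>2 + j) / (?P (N - j) * qpoch (q\<^sup>2 * (q\<^sup>2) ^ N) (q\<^sup>2) j))"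
  have w: "(-1) ^ j * (1 + q ^ (2 * j)) / q ^ (j\<^sup>2 + j) * ?P N / (?P (N - j) * ?P (N + j)) = w j" for j
    unfolding Padd w_def using P[of N] by simp
  have m1: "(-1) ^ N = (-1 :: complex)" using oddN by simp
  have "U m N q = (\<Sum>r<N. q ^ (r\<^sup>2 + (m - 2) * (2 * r\<^sup>2 + 2 * r)) * (1 - q ^ (2 * r + 1)) * ((-1) ^ r * alt_tail q N r))"
    by (rule U_eq_alt_tail) (use nz m in auto)
  also have "\<dots> = (\<Sum>r<N. f r * (1 + q ^ (N\<^sup>2 + N) * (1 / ?P N + (\<Sum>j=1..r. w j))))"
  proof (intro sum.cong refl)
    fix r assume "r \<in> {..<N}"
    then have "(-1) ^ r * alt_tail q N r = q ^ (r\<^sup>2 + r) * (1 + q ^ (N\<^sup>2 + N) * (1 / ?P N + (\<Sum>j=1..r. w j)))"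
      by (subst alt_tail_closed[of q, OF nz q0])
         (simp_all only: w m1 mult_minus_left mult_1_left diff_minus_eq_add lessThan_iff less_imp_le)
    then show "q ^ (r\<^sup>2 + (m - 2) * (2 * r\<^sup>2 + 2 * r)) * (1 - q ^ (2 * r + 1)) * ((-1) ^ r * alt_tail q N r)
       = f r * (1 + q ^ (N\<^sup>2 + N) * (1 / ?P N + (\<Sum>j=1..r. w j)))"
      unfolding f_def theta_term_eq[OF m, symmetric] by (simp only: mult.assoc)
  qed
  also have "\<dots> = (\<Sum>r<N. f r + q ^ (N\<^sup>2 + N) / ?P N * f r + q ^ (N\<^sup>2 + N) * (f r * (\<Sum>j=1..r. w j)))"
    by (intro sum.cong refl) (simp add: algebra_simps)
  also have "\<dots> = (\<Sum>r<N. f r) + q ^ (N\<^sup>2 + N) / ?P N * (\<Sum>r<N. f r) + q ^ (N\<^sup>2 + N) * (\<Sum>r<N. f r * (\<Sum>j=1..r. w j))"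
    by (simp only: sum.distrib sum_distrib_left)
  finally show ?thesis
    unfolding w_def PN by simp
qed

text \<open>
  Of the three parts of \<open>U_split_at_pole\<close>, the first tends to \<open>0\<close> since the theta terms cancel over a
  period, and the third by \<open>sum_reflection_zero\<close>. In the second, the prefactor tends to \<open>1 / N\<close>, and the quotient is
  a difference quotient of exponentials, whose exponents differ by
  \<open>N (A (N - 1 - 2 s) + 1)\<close> in the term with index \<open>s\<close>.
\<close>

lemma U_at_root_of_unity:
  assumes m: "m \<ge> 2"
  shows "U m N \<zeta> = (1 / of_nat N) * (\<Sum>s<N. \<zeta> ^ ((2 * m - 2) * s\<^sup>2 + (2 * m - 3) * s) *
           of_real ((real (2 * m - 2) * (real (N - 1 - s) - real s) + 1) / 2))"
proof -
  define A where "A = 2 * m - 2"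
  have A: "1 \<le> A" "2 * m - 3 = A - 1" using m by (auto simp: A_def)
  define q where "q = (\<lambda>t. \<zeta> * of_real (exp (- t)))"
  define f where "f = (\<lambda>q :: complex. \<lambda>r. q ^ (A * r\<^sup>2 + (A - 1) * r) * (1 - q ^ (2 * r + 1)))"
  define W where "W = (\<lambda>j. (-1) ^ j * (1 + \<zeta> ^ (2 * j)) / \<zeta> ^ (j\<^sup>2 + j) / (qfact (\<zeta>\<^sup>2) (N - j) * qfact (\<zeta>\<^sup>2) j))"
  define w where "w = (\<lambda>q :: complex. \<lambda>j. (-1) ^ j * (1 + q ^ (2 * j)) / q ^ (j\<^sup>2 + j)
          / (qfact (q\<^sup>2) (N - j) * qpoch (q\<^sup>2 * (q\<^sup>2) ^ N) (q\<^sup>2) j))"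
  let ?c = "\<lambda>s. (real A * (real (N - 1 - s) - real s) + 1) / 2"
  have z0: "\<zeta> \<noteq> 0" using z N by (auto simp: power_0_left)
  have norm_z: "norm \<zeta> = 1"
    using z N by (metis norm_one norm_power power_eq_1_iff norm_ge_zero not_one_le_zero)
  have qlim: "(q \<longlongrightarrow> \<zeta>) (at_right 0)"
    unfolding q_def by (auto intro!: tendsto_eq_intros)
  have f_lim: "((\<lambda>t. f (q t) r) \<longlongrightarrow> f \<zeta> r) (at_right 0)" for r
    unfolding f_def by (intro tendsto_intros qlim)
  have f_anti: "f \<zeta> (N - 1 - r) = - f \<zeta> r" if "r < N" for r
  proof -
    have f: "f \<zeta> s = \<zeta> ^ (A * s\<^sup>2 + (A - 1) * s) - \<zeta> ^ (A * u\<^sup>2 + (A - 1) * u)" if "u + s + 1 = N" for u s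
    proof -
      have "s + u + 1 = N" using that by simp
      from reflected_exponent[OF z A(1) this]
      have "\<zeta> ^ (A * u\<^sup>2 + (A - 1) * u) = \<zeta> ^ (A * s\<^sup>2 + (A + 1) * s + 1)" by simp
      also have "A * s\<^sup>2 + (A + 1) * s + 1 = (A * s\<^sup>2 + (A - 1) * s) + (2 * s + 1)"
        using A by (cases A) (simp_all add: algebra_simps)
      finally show ?thesis
        unfolding f_def by (simp only: power_add[of \<zeta> "A * s\<^sup>2 + (A - 1) * s"] right_diff_distrib mult_1_right)
    qed
    show ?thesis
      using f[of r "N - 1 - r"] f[of "N - 1 - r" r] that by simp
  qed
  have w_lim: "((\<lambda>t. w (q t) j) \<longlongrightarrow> W j) (at_right 0)" if j: "1 \<le> j" "j < N" for j
  proof -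
    have "(\<zeta>\<^sup>2) ^ N = 1" by (metis z power_mult mult.commute power_one)
    then have eq: "qpoch (\<zeta>\<^sup>2 * (\<zeta>\<^sup>2) ^ N) (\<zeta>\<^sup>2) j = qfact (\<zeta>\<^sup>2) j" by simp
    have "((\<lambda>t. w (q t) j) \<longlongrightarrow> (-1) ^ j * (1 + \<zeta> ^ (2 * j)) / \<zeta> ^ (j\<^sup>2 + j)
          / (qfact (\<zeta>\<^sup>2) (N - j) * qpoch (\<zeta>\<^sup>2 * (\<zeta>\<^sup>2) ^ N) (\<zeta>\<^sup>2) j)) (at_right 0)"
      unfolding w_def
      by (intro tendsto_intros tendsto_qpoch qlim)
         (use z0 qfact_root_nonzero[of j] qfact_root_nonzero[of "N - j"] j in \<open>auto simp only: eq mult_eq_0_iff power_eq_0_iff\<close>)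
    then show ?thesis unfolding eq W_def .
  qed
  have third: "((\<lambda>t. \<Sum>r<N. f (q t) r * (\<Sum>j=1..r. w (q t) j)) \<longlongrightarrow> 0) (at_right 0)"
  proof -
    have "((\<lambda>t. \<Sum>r<N. f (q t) r * (\<Sum>j=1..r. w (q t) j)) \<longlongrightarrow> (\<Sum>r<N. f \<zeta> r * (\<Sum>j=1..r. W j))) (at_right 0)"
      by (intro tendsto_intros f_lim w_lim) auto
    also have "(\<Sum>r<N. f \<zeta> r * (\<Sum>j=1..r. W j)) = 0"
      by (rule sum_reflection_zero) (rule f_anti, assumption, unfold W_def, rule reflected_weight[OF z oddN], simp)
    finally show ?thesis .
  qed
  have first: "((\<lambda>t. \<Sum>r<N. f (q t) r) \<longlongrightarrow> 0) (at_right 0)"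
  proof -
    have "(\<Sum>r<N. f \<zeta> r) = - (\<Sum>r<N. f \<zeta> r)"
      using sum.nat_diff_reindex[of "f \<zeta>" N] f_anti by (simp flip: sum_negf)
    then have "(\<Sum>r<N. f \<zeta> r) = 0" by (simp add: equal_neg_zero)
    then show ?thesis using tendsto_sum[of "{..<N}" "\<lambda>r t. f (q t) r" "f \<zeta>"] f_lim by simp
  qed
  have second: "((\<lambda>t. (\<Sum>r<N. f (q t) r) / (1 - q t ^ (2 * N))) \<longlongrightarrow>
       (\<Sum>s<N. \<zeta> ^ (A * s\<^sup>2 + (A - 1) * s) * of_real (?c s))) (at_right 0)"
  proof -
    let ?\<alpha> = "\<lambda>s. real (A * s\<^sup>2 + (A - 1) * s)" and ?\<beta> = "\<lambda>s. real (A * (N - 1 - s)\<^sup>2 + (A + 1) * (N - 1 - s) + 1)"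
    have eq: "(\<Sum>r<N. f (q t) r) / (1 - q t ^ (2 * N))
       = (\<Sum>s<N. \<zeta> ^ (A * s\<^sup>2 + (A - 1) * s) * of_real ((exp (- (t * ?\<alpha> s)) - exp (- (t * ?\<beta> s))) / (1 - exp (- (t * (2 * real N))))))" for t
    proof -
      have "\<zeta> ^ (2 * N) = 1" by (metis z power_mult mult.commute power_one)
      then have "1 - q t ^ (2 * N) = of_real (1 - exp (- (t * (2 * real N))))"
        by (simp add: q_def power_mult_distrib exp_of_nat_mult[symmetric] mult_ac flip: of_real_power)
      moreover have "(\<Sum>r<N. f (q t) r) = (\<Sum>s<N. \<zeta> ^ (A * s\<^sup>2 + (A - 1) * s) * of_real (exp (- (t * ?\<alpha> s)) - exp (- (t * ?\<beta> s))))"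
        using partial_theta_block[OF z A(1), of t 0] by (simp add: f_def q_def atLeast0LessThan)
      ultimately show ?thesis
        by (simp only: sum_divide_distrib of_real_divide times_divide_eq_right)
    qed
    have lim: "((\<lambda>t. (exp (- (t * ?\<alpha> s)) - exp (- (t * ?\<beta> s))) / (1 - exp (- (t * (2 * real N))))) \<longlongrightarrow> ?c s) (at_right 0)"
      if "s < N" for s
    proof -
      define u where "u = N - 1 - s"
      have Nu: "N = u + s + 1" using that by (simp add: u_def)
      obtain B where B: "A = Suc B" using A(1) by (cases A) auto
      have "?\<beta> s - ?\<alpha> s = real N * (real A * (real u - real s) + 1)"
        unfolding u_def[symmetric] Nu B by (simp add: power2_eq_square algebra_simps)
      then have eq: "(?\<beta> s - ?\<alpha> s) / (2 * real N) = ?c s"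
        using N unfolding u_def by simp
      have "2 * real N \<noteq> 0" using N by simp
      from exp_difference_quotient_limit[OF this, of "?\<alpha> s" "?\<beta> s"] show ?thesis
        unfolding eq .
    qed
    show ?thesis
      unfolding eq by (intro tendsto_sum tendsto_mult tendsto_const tendsto_of_real lim) simp
  qed
  have pole: "((\<lambda>t. q t ^ (N\<^sup>2 + N) / qfact ((q t)\<^sup>2) (N - 1)) \<longlongrightarrow> 1 / of_nat N) (at_right 0)"
  proof -
    have "\<zeta> ^ (N\<^sup>2 + N) = 1"
      using root_power_add_mult[OF z, of 0 "N + 1"] by (simp add: power2_eq_square algebra_simps)
    moreover have "qfact (\<zeta>\<^sup>2) (N - 1) = of_nat N"
    proof (rule qfact_primitive_root[OF _ _ N])
      show "(\<zeta>\<^sup>2) ^ N = 1" by (metis z power_mult mult.commute power_one)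
    qed (rule root_square_power_neq_1)
    moreover have "((\<lambda>t. q t ^ (N\<^sup>2 + N) / qfact ((q t)\<^sup>2) (N - 1)) \<longlongrightarrow> \<zeta> ^ (N\<^sup>2 + N) / qfact (\<zeta>\<^sup>2) (N - 1)) (at_right 0)"
      using N by (intro tendsto_intros tendsto_qpoch qlim qfact_root_nonzero) auto
    ultimately show ?thesis by simp
  qed
  have "((\<lambda>t. (\<Sum>r<N. f (q t) r) + q t ^ (N\<^sup>2 + N) / qfact ((q t)\<^sup>2) (N - 1) * ((\<Sum>r<N. f (q t) r) / (1 - q t ^ (2 * N)))
     + q t ^ (N\<^sup>2 + N) * (\<Sum>r<N. f (q t) r * (\<Sum>j=1..r. w (q t) j))) \<longlongrightarrow>
     0 + 1 / of_nat N * (\<Sum>s<N. \<zeta> ^ (A * s\<^sup>2 + (A - 1) * s) * of_real (?c s)) + \<zeta> ^ (N\<^sup>2 + N) * 0) (at_right 0)"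
    by (intro tendsto_intros first second third pole qlim)
  moreover have "\<forall>\<^sub>F t in at_right 0. (\<Sum>r<N. f (q t) r) + q t ^ (N\<^sup>2 + N) / qfact ((q t)\<^sup>2) (N - 1) * ((\<Sum>r<N. f (q t) r) / (1 - q t ^ (2 * N)))
     + q t ^ (N\<^sup>2 + N) * (\<Sum>r<N. f (q t) r * (\<Sum>j=1..r. w (q t) j)) = U m N (q t)"
    using eventually_at_right_less[of "0 :: real"]
  proof eventually_elim
    case (elim t)
    have "norm (q t) < 1" "q t \<noteq> 0"
      using elim norm_z z0 by (simp_all add: q_def norm_mult)
    then show ?case
      unfolding f_def w_def A(2)[symmetric] unfolding A_def
      by (intro U_split_at_pole[symmetric] m power_neq_one_of_norm_less) simp_all
  qed
  ultimately have "((\<lambda>t. U m N (q t)) \<longlongrightarrow> 1 / of_nat N * (\<Sum>s<N. \<zeta> ^ (A * s\<^sup>2 + (A - 1) * s) * of_real (?c s))) (at_right 0)"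
    by (simp add: Lim_transform_eventually)
  then have "U m N \<zeta> = 1 / of_nat N * (\<Sum>s<N. \<zeta> ^ (A * s\<^sup>2 + (A - 1) * s) * of_real (?c s))"
    using U_tendsto_at_root[OF qlim] by (intro tendsto_unique[OF trivial_limit_at_right_real])
  then show ?thesis by (simp only: A_def A(2)[unfolded A_def])
qed

end

section \<open>The radial limit\<close>

lemma zeta_pow_primitive:
  assumes N: "1 \<le> N" and M: "coprime M (int N)"
  shows "zeta_pow N (of_int M) ^ N = 1"
    and "\<And>k. 0 < k \<Longrightarrow> k < N \<Longrightarrow> zeta_pow N (of_int M) ^ k \<noteq> 1"
proof -
  have pow: "zeta_pow N (of_int M) ^ k = exp (\<i> * of_real (2 * pi * (real_of_int M * real k / real N)))" for k
    unfolding zeta_pow_def exp_of_nat_mult[symmetric] by (simp add: mult_ac)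
  have "zeta_pow N (of_int M) ^ N = exp (2 * of_int M * of_real pi * \<i>)"
    unfolding pow using N by (simp add: mult_ac)
  then show "zeta_pow N (of_int M) ^ N = 1"
    using exp_integer_2pi[of "of_int M"] by (simp add: mult_ac)
  fix k assume k: "0 < k" "k < N"
  show "zeta_pow N (of_int M) ^ k \<noteq> 1"
  proof
    assume "zeta_pow N (of_int M) ^ k = 1"
    then obtain n :: int where "2 * pi * (real_of_int M * real k / real N) = of_int (2 * n) * pi"
      unfolding pow exp_eq_1 by auto
    then have "real_of_int M * real k = of_int n * real N"
      using N by (simp add: field_simps)
    then have "real_of_int (M * int k) = real_of_int (n * int N)" by simp
    then have "M * int k = n * int N" by (simp only: of_int_eq_iff)
    then have "int N dvd M * int k" by simp
    then have "int N dvd int k"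
      using M by (simp add: coprime_dvd_mult_right_iff coprime_commute)
    then show False using k by (simp add: nat_dvd_not_less)
  qed
qed

theorem theorem3p7:
  fixes m N :: nat and M :: int
  assumes "m \<ge> 2" and "N \<ge> 1" and "odd N" and "coprime M (int N)"
  shows "((\<lambda>t::real. Gamma_tilde m (of_int M / of_nat N + \<i> * of_real (t / (2 * pi))))
           \<longlongrightarrow> zeta_pow N (of_int M * (2 * real m - 3)\<^sup>2 / (8 * (real m - 1)))
               * U m N (zeta_pow N (of_int M)))
         (at_right 0)"
proof -
  define \<zeta> where "\<zeta> = zeta_pow N (of_int M)"
  define A where "A = 2 * m - 2"
  have A: "1 \<le> A" "2 * m - 3 = A - 1" using assms(1) by (auto simp: A_def)
  have z: "\<zeta> ^ N = 1" and prim: "\<And>k. 0 < k \<Longrightarrow> k < N \<Longrightarrow> \<zeta> ^ k \<noteq> 1"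
    unfolding \<zeta>_def using zeta_pow_primitive[OF assms(2,4)] by blast+
  define \<tau> :: "real \<Rightarrow> complex" where "\<tau> = (\<lambda>t. of_int M / of_nat N + \<i> * of_real (t / (2 * pi)))"
  define S where "S = (\<lambda>t. \<Sum>\<^sub>\<infinity>n\<in>({1..m-1} \<rightarrow>\<^sub>E UNIV). summand m (exp (2 * of_real pi * \<i> * \<tau> t)) n)"
  let ?k = "\<lambda>s. real A * (real (N - 1 - s) - real s) + 1"
  have q: "exp (2 * of_real pi * \<i> * \<tau> t) = \<zeta> * of_real (exp (- t))" for t
  proof -
    have "2 * of_real pi * \<i> * \<tau> t = 2 * of_real pi * \<i> * of_real (of_int M) / of_nat N + of_real (- t)"
      by (simp add: \<tau>_def field_simps)
    then show ?thesis by (simp only: exp_add \<zeta>_def zeta_pow_def exp_of_real)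
  qed
  have "norm \<zeta> = 1" by (simp add: \<zeta>_def zeta_pow_def norm_exp_eq_Re)
  then have "(\<lambda>r. (\<zeta> * of_real (exp (- t))) ^ (A * r\<^sup>2 + (A - 1) * r) * (1 - (\<zeta> * of_real (exp (- t))) ^ (2 * r + 1))) sums S t"
    if "0 < t" for t
    unfolding S_def q A(2)[symmetric] unfolding A_def
    using that assms(1) by (intro infsum_summand_sums) (auto simp: norm_mult)
  then have S_lim: "(S \<longlongrightarrow> (\<Sum>s<N. \<zeta> ^ (A * s\<^sup>2 + (A - 1) * s) * of_real (?k s / (real A * real N)))) (at_right 0)"
    by (intro partial_theta_radial_limit z assms(2) A(1))
  have pre_lim: "((\<lambda>t. of_nat (m - 1) * exp (2 * of_real pi * \<i> * of_real ((2 * real m - 3)\<^sup>2 / (8 * (real m - 1))) * \<tau> t)) \<longlongrightarrow>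
      of_nat (m - 1) * zeta_pow N (of_int M * (2 * real m - 3)\<^sup>2 / (8 * (real m - 1)))) (at_right 0)"
  proof -
    have "(\<tau> \<longlongrightarrow> of_int M / of_nat N) (at_right 0)"
      unfolding \<tau>_def by (auto intro!: tendsto_eq_intros)
    moreover have "zeta_pow N (of_int M * (2 * real m - 3)\<^sup>2 / (8 * (real m - 1)))
       = exp (2 * of_real pi * \<i> * of_real ((2 * real m - 3)\<^sup>2 / (8 * (real m - 1))) * (of_int M / of_nat N))"
      unfolding zeta_pow_def by (simp add: mult_ac)
    ultimately show ?thesis by (simp only:) (intro tendsto_intros)
  qed
  have "((\<lambda>t. Gamma_tilde m (\<tau> t)) \<longlongrightarrow>
      of_nat (m - 1) * zeta_pow N (of_int M * (2 * real m - 3)\<^sup>2 / (8 * (real m - 1)))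
        * (\<Sum>s<N. \<zeta> ^ (A * s\<^sup>2 + (A - 1) * s) * of_real (?k s / (real A * real N)))) (at_right 0)"
    unfolding Gamma_tilde_def by (rule tendsto_mult[OF pre_lim S_lim[unfolded S_def]])
  also have "of_nat (m - 1) * zeta_pow N (of_int M * (2 * real m - 3)\<^sup>2 / (8 * (real m - 1)))
        * (\<Sum>s<N. \<zeta> ^ (A * s\<^sup>2 + (A - 1) * s) * of_real (?k s / (real A * real N)))
     = zeta_pow N (of_int M * (2 * real m - 3)\<^sup>2 / (8 * (real m - 1))) * U m N \<zeta>"
  proof -
    have "of_nat (m - 1) * (\<zeta> ^ (A * s\<^sup>2 + (A - 1) * s) * of_real (?k s / (real A * real N)))
       = 1 / of_nat N * (\<zeta> ^ (A * s\<^sup>2 + (A - 1) * s) * of_real (?k s / 2))" for s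
    proof -
      have "real A = 2 * real (m - 1)" "real (m - 1) \<noteq> 0" using assms(1) by (auto simp: A_def)
      moreover have "c \<noteq> 0 \<Longrightarrow> c * (k / (2 * c * n)) = 1 / n * (k / 2)" for c k n :: real
        by simp
      ultimately have "real (m - 1) * (?k s / (real A * real N)) = 1 / real N * (?k s / 2)"
        by (simp only:)
      then have "of_real (real (m - 1) * (?k s / (real A * real N))) = (of_real (1 / real N * (?k s / 2)) :: complex)"
        by (simp only:)
      then have "of_nat (m - 1) * of_real (?k s / (real A * real N)) = (1 / of_nat N * of_real (?k s / 2) :: complex)"
        by (simp only: of_real_mult of_real_of_nat_eq of_real_divide of_real_1)
      moreover have "a * x = b * y \<Longrightarrow> a * (w * x) = b * (w * y)" for a b w x y :: complex
        by (metis mult.left_commute)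
      ultimately show ?thesis by blast
    qed
    then have "of_nat (m - 1) * (\<Sum>s<N. \<zeta> ^ (A * s\<^sup>2 + (A - 1) * s) * of_real (?k s / (real A * real N)))
        = 1 / of_nat N * (\<Sum>s<N. \<zeta> ^ (A * s\<^sup>2 + (A - 1) * s) * of_real (?k s / 2))"
      unfolding sum_distrib_left by (intro sum.cong refl)
    also have "\<dots> = U m N \<zeta>"
      using U_at_root_of_unity[OF z prim assms(2,3,1)] by (simp only: A_def A(2)[unfolded A_def])
    finally have "of_nat (m - 1) * (\<Sum>s<N. \<zeta> ^ (A * s\<^sup>2 + (A - 1) * s) * of_real (?k s / (real A * real N))) = U m N \<zeta>" .
    moreover have "a * x = y \<Longrightarrow> a * w * x = w * y" for a w x y :: complex
      by (simp add: mult_ac)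
    ultimately show ?thesis by blast
  qed
  finally show ?thesis by (simp only: \<tau>_def \<zeta>_def)
qed

end
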